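(* Let $(X_i)_{i\ge 1}$ be i.i.d. real-valued random variables with $\mathbb E(X_1)=0$, $\mathbb E(X_1^2)=\sigma^2>0$, and suppose there exists $\delta>0$ such that $\mathbb E(|X_1|^{2+\delta})<\infty$. Then for any $a\in\operatorname{supp}V$, as $n\to\infty$, uniformly over $x\in[a,\infty)$, $$\mathbb P(\tau_x>n)\sim\frac{V(x)\,L\left(\frac{x}{\sigma\sqrt n}\right)}{\sigma\sqrt n},$$ i.e. $\lim_{n\to\infty}\sup_{x\ge a}\left|\frac{\sigma\sqrt n\,\mathbb P(\tau_x>n)}{V(x)L(x/(\sigma\sqrt n))}-1\right|=0$. In particular, since $V(0)>0$, the equivalence holds uniformly over $x\in[0,\infty)$.
   Context: Let $S_n=\sum_{i=1}^n X_i$ for $n\ge1$. For $x\in\mathbb R$, $\tau_x=\inf\{k\ge 1: x+S_k<0\}$ (with $\inf\emptyset=\infty$). Define $V(x)=-\mathbb E(S_{\tau_x})$ for $x\in\mathbb R$; under the stated moment assumptions it is known that $V$ is well defined, non-negative and non-decreasing, and that $V(x)=\lim_{n\to\infty}\mathbb E\big((x+S_n)\mathbf 1_{\{\tau_x>n\}}\big)$. The notation $\operatorname{supp}V$ means the set where $V>0$, and it is known that $\operatorname{supp}V=\{x\in\mathbb R:\mathbb P(x+X_1\ge 0)>0\}$; in particular $V(0)>0$. Let $\Phi$ be the standard normal distribution function and $H(x)=2\Phi(x)-1$. Define $L(x)=H(x)/x$ for $x\neq 0$ and $L(0)=2/\sqrt{2\pi}$. *)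

theory Defs
  imports "HOL-Probability.Probability"
begin

definition walk :: "(nat \<Rightarrow> 'a \<Rightarrow> real) \<Rightarrow> nat \<Rightarrow> 'a \<Rightarrow> real" where
  "walk X n \<omega> = (\<Sum>i=1..n. X i \<omega>)"

(* In the complete lattice enat the infimum of the empty set is \<infinity>. *)
definition exit_time :: "(nat \<Rightarrow> 'a \<Rightarrow> real) \<Rightarrow> real \<Rightarrow> 'a \<Rightarrow> enat" where
  "exit_time X x \<omega> = Inf (enat ` {k. 1 \<le> k \<and> x + walk X k \<omega> < 0})"

(* The value 0 where the exit time is infinite is a convention: for a centred walk with
   positive finite variance that event is null. *)
definition exit_position :: "(nat \<Rightarrow> 'a \<Rightarrow> real) \<Rightarrow> real \<Rightarrow> 'a \<Rightarrow> real" where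
  "exit_position X x \<omega> =
     (case exit_time X x \<omega> of enat k \<Rightarrow> walk X k \<omega> | \<infinity> \<Rightarrow> 0)"

definition V :: "'a measure \<Rightarrow> (nat \<Rightarrow> 'a \<Rightarrow> real) \<Rightarrow> real \<Rightarrow> real" where
  "V M X x = - (\<integral>\<omega>. exit_position X x \<omega> \<partial>M)"

(* The set where V is positive, without topological closure. *)
definition supp_V :: "'a measure \<Rightarrow> (nat \<Rightarrow> 'a \<Rightarrow> real) \<Rightarrow> real set" where
  "supp_V M X = {x. V M X x > 0}"

definition H :: "real \<Rightarrow> real" where
  "H x = 2 * cdf std_normal_distribution x - 1"

definition L :: "real \<Rightarrow> real" where
  "L x = (if x = 0 then 2 / sqrt (2 * pi) else H x / x)"

end

theory Submission
  imports Defs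
begin

text \<open>Write \<open>z = \<sigma> * sqrt n\<close>. For starting points \<open>x\<close> of order at least \<open>\<epsilon> * z\<close> the claim is the limit law
  \<open>P (\<tau>\<^sub>x > n) - H (x / z) \<longlonglongrightarrow> 0\<close>, uniformly in \<open>x \<ge> 0\<close>, together with \<open>V x \<sim> x\<close>. The limit law follows from the
  central limit theorem by an approximate reflection principle: the overshoot at \<open>\<tau>\<^sub>x\<close> is negligible,
  and the walk after \<open>\<tau>\<^sub>x\<close> moves down with probability close to one half.

  For \<open>a \<le> x \<le> b = \<epsilon> * z\<close> the walk is stopped when it leaves \<open>[0, b]\<close>. The function \<open>V\<close> is harmonic for the
  walk killed below zero, so the mean position on leaving through the top is asymptotically \<open>V x\<close>, and
  from a position \<open>y > b\<close> of order \<open>z\<close> the survival probability is about \<open>H (y / z)\<close>, that is, \<open>L 0 * y / z\<close> when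
  \<open>\<epsilon>\<close> is small. The mean exit time is at most a multiple of \<open>b * V x\<close>, so it is negligible that the exit
  takes a positive fraction of the time \<open>n\<close>, and that the walk jumps over \<open>2 * b\<close>. Since \<open>n\<close> tends to infinity
  before \<open>\<epsilon>\<close> tends to zero, no rate of convergence is needed in the limit law.

  Stopping times are avoided: with the operator \<open>f \<mapsto> E (f (x + X\<^sub>1); x + X\<^sub>1 \<in> A)\<close> every first passage
  decomposition becomes an inequality proved by induction on the number of steps.\<close>

section \<open>Random walks and the transition operator of the killed walk\<close>

text \<open>For bounded \<open>x\<close> the survival probability is of order \<open>1 / z\<close>,
  far below the error of a limit law without a rate. Near the boundary every error therefore has to
  be a multiple of \<open>V x / z\<close>: the bounds on the time spent in the strip and on the
  overshoot carry the factor \<open>V x\<close>, and harmonicity carries a bound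
  \<open>\<kappa> * V y\<close> at the exit point back to \<open>\<kappa> * V x\<close>.
  \<open>V\<close> is first built as the increasing limit of E (x + S_n; tau_x > n), under the name
  \<open>renewal\<close>. It is identified with the mean exit position only after the limit law has
  shown that the exit time is almost surely finite. The moment of order \<open>2 + \<delta>\<close>
  acts through a single bound, \<open>tail_mean_le\<close>, on the mean of a step beyond a level
  \<open>c\<close>, of order \<open>c powr - (1 + \<delta>)\<close>. It controls the undershoot in
  the superharmonic majorant, the large downward jumps before time \<open>n\<close>, and the jumps
  across the strip.\<close>

definition linear_growth :: "(real \<Rightarrow> real) \<Rightarrow> bool" where
  "linear_growth f \<longleftrightarrow> f \<in> borel_measurable borel \<and> (\<exists>c. \<forall>y. \<bar>f y\<bar> \<le> c * (1 + \<bar>y\<bar>))"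

lemma linear_growthI:
  assumes "f \<in> borel_measurable borel" "\<And>y. \<bar>f y\<bar> \<le> c * (1 + \<bar>y\<bar>)"
  shows "linear_growth f"
  using assms unfolding linear_growth_def by blast

lemma linear_growth_measurable [measurable_dest]:
  "linear_growth f \<Longrightarrow> f \<in> borel_measurable borel"
  unfolding linear_growth_def by blast

lemma linear_growth_bound:
  assumes "linear_growth f"
  shows "\<exists>c\<ge>0. \<forall>y. \<bar>f y\<bar> \<le> c * (1 + \<bar>y\<bar>)"
proof -
  obtain c where c: "\<forall>y. \<bar>f y\<bar> \<le> c * (1 + \<bar>y\<bar>)"
    using assms unfolding linear_growth_def by blast
  then have "\<bar>f 0\<bar> \<le> c * (1 + \<bar>0\<bar>)" by blast
  then have "c \<ge> 0" by simp
  then show ?thesis using c by blast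
qed

lemma linear_growth_bounded:
  assumes "f \<in> borel_measurable borel" "\<And>y. \<bar>f y\<bar> \<le> c"
  shows "linear_growth f"
proof (rule linear_growthI[OF assms(1)])
  fix y
  have "0 \<le> c" using assms(2)[of 0] by linarith
  then show "\<bar>f y\<bar> \<le> c * (1 + \<bar>y\<bar>)"
    using assms(2)[of y] by (simp add: distrib_left add_increasing2)
qed

lemma linear_growth_indicator_mult:
  assumes "linear_growth f" and [measurable]: "A \<in> sets borel"
  shows "linear_growth (\<lambda>y. indicator A y * f y)"
proof -
  note [measurable] = linear_growth_measurable[OF assms(1)]
  obtain c where c: "c \<ge> 0" "\<And>y. \<bar>f y\<bar> \<le> c * (1 + \<bar>y\<bar>)" using linear_growth_bound[OF assms(1)] by blast
  show ?thesis
    using c by (auto intro!: linear_growthI[of _ c] simp: indicator_def)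
qed

lemma linear_growth_add:
  assumes "linear_growth f" "linear_growth g"
  shows "linear_growth (\<lambda>y. f y + g y)"
proof -
  note [measurable] = assms[THEN linear_growth_measurable]
  obtain c where c: "c \<ge> 0" "\<And>y. \<bar>f y\<bar> \<le> c * (1 + \<bar>y\<bar>)" using linear_growth_bound[OF assms(1)] by blast
  obtain d where d: "d \<ge> 0" "\<And>y. \<bar>g y\<bar> \<le> d * (1 + \<bar>y\<bar>)" using linear_growth_bound[OF assms(2)] by blast
  show ?thesis
  proof (rule linear_growthI[of _ "c + d"])
    show "\<bar>f y + g y\<bar> \<le> (c + d) * (1 + \<bar>y\<bar>)" for y
      using c(2)[of y] d(2)[of y] by (simp only: distrib_right)
  qed measurable
qed

lemma linear_growth_cmult:
  assumes "linear_growth f"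
  shows "linear_growth (\<lambda>y. a * f y)"
proof -
  note [measurable] = assms[THEN linear_growth_measurable]
  obtain c where c: "c \<ge> 0" "\<And>y. \<bar>f y\<bar> \<le> c * (1 + \<bar>y\<bar>)" using linear_growth_bound[OF assms(1)] by blast
  show ?thesis
  proof (rule linear_growthI[of _ "\<bar>a\<bar> * c"])
    show "\<bar>a * f y\<bar> \<le> \<bar>a\<bar> * c * (1 + \<bar>y\<bar>)" for y
      using mult_left_mono[OF c(2)[of y] abs_ge_zero[of a]] by (simp add: abs_mult mult.assoc)
  qed measurable
qed

lemma linear_growth_const [simp]: "linear_growth (\<lambda>_. c)"
  by (rule linear_growth_bounded[of _ "\<bar>c\<bar>"]) auto

lemma linear_growth_id [simp]: "linear_growth (\<lambda>y. y)"
  by (rule linear_growthI[of _ 1]) auto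

lemma linear_growth_diff:
  assumes "linear_growth f" "linear_growth g"
  shows "linear_growth (\<lambda>y. f y - g y)"
  using linear_growth_add[OF assms(1) linear_growth_cmult[OF assms(2), of "-1"]] by simp

text \<open>Only a finite first moment is assumed at this level; it suffices for the operator, for
  monotonicity and for the two inequalities that replace reflection.\<close>

locale random_walk = prob_space M for M :: "'a measure" +
  fixes X :: "nat \<Rightarrow> 'a \<Rightarrow> real"
  assumes indep: "indep_vars (\<lambda>_. borel) X {1..}"
    and identical: "\<And>i. 1 \<le> i \<Longrightarrow> distr M borel (X i) = distr M borel (X 1)"
    and integrable_step: "integrable M (X 1)"
begin

definition \<mu> :: "real measure" where "\<mu> = distr M borel (X 1)"

lemma X_measurable: "1 \<le> i \<Longrightarrow> X i \<in> borel_measurable M"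
  using indep by (auto simp: indep_vars_def)

lemma walk_measurable [measurable]: "walk X n \<in> borel_measurable M"
proof -
  have "(\<lambda>\<omega>. \<Sum>i=1..n. X i \<omega>) \<in> borel_measurable M"
    by (intro borel_measurable_sum) (auto intro: X_measurable)
  then show ?thesis by (simp add: walk_def[abs_def])
qed

sublocale \<mu>: real_distribution \<mu>
  unfolding \<mu>_def by (rule real_distribution_distr) (simp add: X_measurable)

lemma integrable_X:
  assumes "1 \<le> i" shows "integrable M (X i)"
proof -
  have m: "X i \<in> borel_measurable M" "X 1 \<in> borel_measurable M" using X_measurable assms by auto
  have "integrable (distr M borel (X 1)) (\<lambda>t. t)"
    using integrable_step m by (simp add: integrable_distr_eq)
  then have "integrable (distr M borel (X i)) (\<lambda>t. t)" using identical[OF assms] by simp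
  then show ?thesis using m by (simp add: integrable_distr_eq)
qed

lemma integrable_walk: "integrable M (walk X n)"
  unfolding walk_def[abs_def] by (intro Bochner_Integration.integrable_sum) (auto intro: integrable_X)

lemma integrable_id: "integrable \<mu> (\<lambda>t. t)"
  using integrable_step X_measurable[of 1] unfolding \<mu>_def by (simp add: integrable_distr_eq)

text \<open>Linear growth is the class on which the operator acts: a finite first moment makes every
  shift of such a function integrable, and indicators, the identity and \<open>V\<close> all belong
  to it.\<close>

lemma integrable_linear_growth:
  assumes "linear_growth f" shows "integrable \<mu> (\<lambda>t. f (x + t))"
proof -
  note [measurable] = linear_growth_measurable[OF assms]
  obtain c where c: "c \<ge> 0" "\<And>y. \<bar>f y\<bar> \<le> c * (1 + \<bar>y\<bar>)" using linear_growth_bound[OF assms(1)] by blast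
  show ?thesis
  proof (rule Bochner_Integration.integrable_bound)
    show "integrable \<mu> (\<lambda>t. c * (1 + \<bar>x\<bar> + \<bar>t\<bar>))"
      using integrable_id by auto
    have "\<bar>f (x + t)\<bar> \<le> c * (1 + \<bar>x\<bar> + \<bar>t\<bar>)" for t
      by (rule order_trans[OF c(2)]) (intro mult_left_mono c, linarith)
    then show "AE t in \<mu>. norm (f (x + t)) \<le> norm (c * (1 + \<bar>x\<bar> + \<bar>t\<bar>))"
      using c(1) by (auto simp: abs_mult)
  qed measurable
qed

text \<open>The indicator tests the position after the step, not the starting point. This matches
  \<open>exit_time\<close>, which looks at times \<open>k \<ge> 1\<close> only, so that negative
  starting points are meaningful.\<close>

definition kill :: "real set \<Rightarrow> (real \<Rightarrow> real) \<Rightarrow> real \<Rightarrow> real" where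
  "kill A f x = (\<integral>t. indicator A (x + t) * f (x + t) \<partial>\<mu>)"

lemma integrable_kill:
  assumes "linear_growth f" "A \<in> sets borel"
  shows "integrable \<mu> (\<lambda>t. indicator A (x + t) * f (x + t))"
  using integrable_linear_growth[OF linear_growth_indicator_mult[OF assms]] .

lemma linear_growth_kill:
  assumes "linear_growth f" and [measurable]: "A \<in> sets borel"
  shows "linear_growth (kill A f)"
proof -
  note [measurable] = linear_growth_measurable[OF assms(1)]
  obtain c where c: "c \<ge> 0" "\<And>y. \<bar>f y\<bar> \<le> c * (1 + \<bar>y\<bar>)" using linear_growth_bound[OF assms(1)] by blast
  define d where "d = (\<integral>t. \<bar>t\<bar> \<partial>\<mu>)"
  have d0: "d \<ge> 0" unfolding d_def by simp
  show ?thesis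
  proof (rule linear_growthI[of _ "c * (1 + d)"])
    show "kill A f \<in> borel_measurable borel"
      unfolding kill_def[abs_def] by measurable
  next
    fix x
    have "\<bar>kill A f x\<bar> \<le> (\<integral>t. \<bar>indicator A (x + t) * f (x + t)\<bar> \<partial>\<mu>)"
      unfolding kill_def by (rule integral_abs_bound)
    also have "\<dots> \<le> (\<integral>t. c * (1 + \<bar>x\<bar> + \<bar>t\<bar>) \<partial>\<mu>)"
    proof (rule integral_mono)
      show "integrable \<mu> (\<lambda>t. \<bar>indicator A (x + t) * f (x + t)\<bar>)"
        using integrable_kill[OF assms] by auto
      show "integrable \<mu> (\<lambda>t. c * (1 + \<bar>x\<bar> + \<bar>t\<bar>))" using integrable_id by auto
      fix t
      have "\<bar>f (x + t)\<bar> \<le> c * (1 + \<bar>x\<bar> + \<bar>t\<bar>)"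
        by (rule order_trans[OF c(2)]) (intro mult_left_mono c, linarith)
      then show "\<bar>indicator A (x + t) * f (x + t)\<bar> \<le> c * (1 + \<bar>x\<bar> + \<bar>t\<bar>)"
        using c(1) by (auto simp: indicator_def)
    qed
    also have "\<dots> = c * (1 + \<bar>x\<bar> + d)"
      using integrable_id by (simp add: d_def \<mu>.prob_space[simplified])
    also have "\<dots> \<le> c * (1 + d) * (1 + \<bar>x\<bar>)"
      using c(1) d0 by (simp add: algebra_simps)
    finally show "\<bar>kill A f x\<bar> \<le> c * (1 + d) * (1 + \<bar>x\<bar>)" .
  qed
qed

lemma linear_growth_kill_pow:
  assumes "linear_growth f" "A \<in> sets borel"
  shows "linear_growth ((kill A ^^ n) f)"
  by (induction n) (auto intro: linear_growth_kill assms)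

lemma kill_mono:
  assumes "linear_growth f" "linear_growth g" "A \<in> sets borel"
    and "\<And>y. y \<in> A \<Longrightarrow> f y \<le> g y"
  shows "kill A f x \<le> kill A g x"
  unfolding kill_def
  by (intro integral_mono integrable_kill assms) (auto simp: indicator_def assms(4))

lemma kill_diff:
  assumes "linear_growth f" "linear_growth g" "A \<in> sets borel"
  shows "kill A (\<lambda>y. f y - g y) x = kill A f x - kill A g x"
  unfolding kill_def right_diff_distrib
  by (intro Bochner_Integration.integral_diff integrable_kill assms)

lemma kill_cmult: "kill A (\<lambda>y. a * f y) x = a * kill A f x"
  unfolding kill_def by (simp add: mult.left_commute)

section \<open>Expectations over surviving paths as iterates of the operator\<close>

definition alive :: "real set \<Rightarrow> nat \<Rightarrow> real \<Rightarrow> 'a \<Rightarrow> real" where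
  "alive A n x \<omega> = (\<Prod>k=1..n. indicator A (x + walk X k \<omega>))"

lemma alive_measurable [measurable]:
  assumes [measurable]: "A \<in> sets borel"
  shows "alive A n x \<in> borel_measurable M"
  unfolding alive_def[abs_def] by measurable

lemma alive_nonneg: "0 \<le> alive A n x \<omega>" and alive_le_1: "alive A n x \<omega> \<le> 1"
  unfolding alive_def by (auto intro!: prod_nonneg prod_le_1)

lemma alive_Suc: "alive A (Suc n) x \<omega> = alive A n x \<omega> * indicator A (x + walk X (Suc n) \<omega>)"
  unfolding alive_def by simp

lemma alive_0: "alive A 0 x \<omega> = 1"
  unfolding alive_def by simp

lemma integrable_walk_growth:
  assumes "linear_growth f" shows "integrable M (\<lambda>\<omega>. f (x + walk X n \<omega>))"
proof -
  note [measurable] = linear_growth_measurable[OF assms]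
  obtain c where c: "c \<ge> 0" "\<And>y. \<bar>f y\<bar> \<le> c * (1 + \<bar>y\<bar>)" using linear_growth_bound[OF assms(1)] by blast
  show ?thesis
  proof (rule Bochner_Integration.integrable_bound)
    show "integrable M (\<lambda>\<omega>. c * (1 + \<bar>x\<bar> + \<bar>walk X n \<omega>\<bar>))"
      using integrable_walk by auto
    have "\<bar>f (x + t)\<bar> \<le> c * (1 + \<bar>x\<bar> + \<bar>t\<bar>)" for t
      by (rule order_trans[OF c(2)]) (intro mult_left_mono c, linarith)
    then show "AE \<omega> in M. norm (f (x + walk X n \<omega>)) \<le> norm (c * (1 + \<bar>x\<bar> + \<bar>walk X n \<omega>\<bar>))"
      using c(1) by (auto simp: abs_mult)
  qed measurable
qed

lemma integrable_alive_mult: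
  assumes "integrable M f" "A \<in> sets borel"
  shows "integrable M (\<lambda>\<omega>. alive A n x \<omega> * f \<omega>)"
proof (rule Bochner_Integration.integrable_bound[OF assms(1)])
  show "(\<lambda>\<omega>. alive A n x \<omega> * f \<omega>) \<in> borel_measurable M"
    using assms by measurable
  show "AE \<omega> in M. norm (alive A n x \<omega> * f \<omega>) \<le> norm (f \<omega>)"
    using alive_nonneg alive_le_1 by (auto simp: abs_mult intro!: mult_left_le_one_le)
qed

text \<open>The first \<open>n\<close> steps determine the survival indicator and the position and
  are independent of the next step, so Fubini integrates that step alone. The next step is not
  tested against \<open>A\<close>; this free form also yields the martingale property of the stopped
  walk.\<close>

lemma expectation_alive_step:
  assumes f: "linear_growth f" and A[measurable]: "A \<in> sets borel"
  shows "(\<integral>\<omega>. alive A n x \<omega> * f (x + walk X (Suc n) \<omega>) \<partial>M)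
       = (\<integral>\<omega>. alive A n x \<omega> * kill UNIV f (x + walk X n \<omega>) \<partial>M)"
proof -
  note [measurable] = linear_growth_measurable[OF f]
    linear_growth_measurable[OF linear_growth_kill[OF f, of UNIV]]
  define P where "P = (PiM {1..n} (\<lambda>_. borel :: real measure))"
  define R where "R \<omega> = restrict (\<lambda>i. X i \<omega>) {1..n}" for \<omega>
  define a where "a r = (\<Prod>k=1..n. indicator A (x + (\<Sum>i=1..k. r i)) :: real)" for r :: "nat \<Rightarrow> real"
  define w where "w r = x + (\<Sum>i=1..n. r i)" for r :: "nat \<Rightarrow> real"
  have sum_meas: "(\<lambda>r. \<Sum>i=1..k. r i) \<in> borel_measurable P" if "k \<le> n" for k
    unfolding P_def using that by (intro borel_measurable_sum measurable_component_singleton) auto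
  have a_meas[measurable]: "a \<in> borel_measurable P"
  proof -
    have "(\<lambda>r. indicator A (x + (\<Sum>i=1..k. r i)) :: real) \<in> borel_measurable P" if "k \<le> n" for k
      using sum_meas[OF that] by measurable
    then show ?thesis unfolding a_def[abs_def] by (intro borel_measurable_prod) auto
  qed
  have w_meas[measurable]: "w \<in> borel_measurable P"
    unfolding w_def[abs_def] using sum_meas[of n] by measurable
  \<comment> \<open>Step \<open>Suc n\<close> is kept as a function on a singleton index set, so
    that both blocks are restrictions of the same family; \<open>dT\<close> recovers its law
    \<mu>.\<close>
  define P' where "P' = (PiM {Suc n} (\<lambda>_. borel :: real measure))"
  define T where "T \<omega> = restrict (\<lambda>i. X i \<omega>) {Suc n}" for \<omega>
  have iv: "indep_var P R P' T"
    unfolding P_def P'_def R_def[abs_def] T_def[abs_def]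
    by (rule indep_var_restrict[OF indep]) auto
  have Rm[measurable]: "R \<in> measurable M P" and Tm[measurable]: "T \<in> measurable M P'"
    using iv by (auto dest: indep_var_rv1 indep_var_rv2)
  have c[measurable]: "(\<lambda>q. q (Suc n)) \<in> borel_measurable P'"
    unfolding P'_def by (rule measurable_component_singleton) auto
  have dX: "distr M borel (X (Suc n)) = \<mu>" unfolding \<mu>_def by (rule identical) simp
  have dT: "distr (distr M P' T) borel (\<lambda>q. q (Suc n)) = \<mu>"
    unfolding dX[symmetric] by (subst distr_distr) (auto simp: comp_def T_def)
  interpret R: prob_space "distr M P R" by (rule prob_space_distr) measurable
  interpret T: prob_space "distr M P' T" by (rule prob_space_distr) measurable
  interpret pair_sigma_finite "distr M P R" "distr M P' T" ..
  have joint: "distr M P R \<Otimes>\<^sub>M distr M P' T = distr M (P \<Otimes>\<^sub>M P') (\<lambda>\<omega>. (R \<omega>, T \<omega>))"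
    using iv unfolding indep_var_distribution_eq by blast
  have aR: "a (R \<omega>) = alive A n x \<omega>" for \<omega>
    unfolding a_def R_def alive_def walk_def by (intro prod.cong refl arg_cong[where f="indicator A"]) (auto intro!: sum.cong)
  have wR: "w (R \<omega>) = x + walk X n \<omega>" for \<omega>
    unfolding w_def R_def walk_def by (auto intro!: sum.cong)
  have wS: "x + walk X (Suc n) \<omega> = w (R \<omega>) + T \<omega> (Suc n)" for \<omega>
    unfolding wR by (simp add: walk_def T_def)
  let ?g = "\<lambda>(r, q). a r * f (w r + q (Suc n))"
  have gm: "?g \<in> borel_measurable (P \<Otimes>\<^sub>M P')"
    by measurable
  have pm: "(\<lambda>\<omega>. (R \<omega>, T \<omega>)) \<in> measurable M (P \<Otimes>\<^sub>M P')" by measurable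
  have int: "integrable (distr M P R \<Otimes>\<^sub>M distr M P' T) ?g"
    unfolding joint integrable_distr_eq[OF pm gm]
    by (auto simp: aR wS[symmetric] intro!: integrable_alive_mult integrable_walk_growth f A)
  have "(\<integral>\<omega>. alive A n x \<omega> * f (x + walk X (Suc n) \<omega>) \<partial>M) = (\<integral>\<omega>. ?g (R \<omega>, T \<omega>) \<partial>M)"
    by (simp add: aR wS)
  also have "\<dots> = (\<integral>z. ?g z \<partial>(distr M P R \<Otimes>\<^sub>M distr M P' T))"
    unfolding joint by (rule integral_distr[OF pm gm, symmetric])
  also have "\<dots> = (\<integral>r. (\<integral>q. ?g (r, q) \<partial>distr M P' T) \<partial>distr M P R)"
    by (rule integral_fst'[OF int, symmetric])
  also have "\<dots> = (\<integral>r. a r * kill UNIV f (w r) \<partial>distr M P R)"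
  proof -
    have "(\<integral>q. f (y + q (Suc n)) \<partial>distr M P' T) = kill UNIV f y" for y
    proof -
      have "kill UNIV f y = (\<integral>t. f (y + t) \<partial>distr (distr M P' T) borel (\<lambda>q. q (Suc n)))"
        unfolding kill_def dT by simp
      also have "\<dots> = (\<integral>q. f (y + q (Suc n)) \<partial>distr M P' T)"
        by (rule integral_distr) measurable
      finally show ?thesis by simp
    qed
    then show ?thesis by simp
  qed
  also have "\<dots> = (\<integral>\<omega>. a (R \<omega>) * kill UNIV f (w (R \<omega>)) \<partial>M)"
    by (rule integral_distr) measurable
  finally show ?thesis by (simp add: aR wR)
qed

text \<open>Peeling off the last step replaces \<open>f\<close> by \<open>kill A f\<close>, so the
  induction has to run over all \<open>f\<close>.\<close>

lemma expectation_alive: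
  assumes "linear_growth f" and A: "A \<in> sets borel"
  shows "(\<integral>\<omega>. alive A n x \<omega> * f (x + walk X n \<omega>) \<partial>M) = (kill A ^^ n) f x"
  using assms(1)
proof (induction n arbitrary: f)
  case 0
  then show ?case by (simp add: alive_0 walk_def prob_space)
next
  case (Suc n)
  have "(\<integral>\<omega>. alive A (Suc n) x \<omega> * f (x + walk X (Suc n) \<omega>) \<partial>M)
      = (\<integral>\<omega>. alive A n x \<omega> * (indicator A (x + walk X (Suc n) \<omega>) * f (x + walk X (Suc n) \<omega>)) \<partial>M)"
    by (simp add: alive_Suc mult.assoc)
  also have "\<dots> = (\<integral>\<omega>. alive A n x \<omega> * kill UNIV (\<lambda>y. indicator A y * f y) (x + walk X n \<omega>) \<partial>M)"
    by (rule expectation_alive_step) (intro linear_growth_indicator_mult Suc.prems A, rule A)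
  also have "\<dots> = (\<integral>\<omega>. alive A n x \<omega> * kill A f (x + walk X n \<omega>) \<partial>M)"
    by (simp add: kill_def)
  also have "\<dots> = (kill A ^^ n) (kill A f) x"
    by (rule Suc.IH) (intro linear_growth_kill Suc.prems A)
  also have "\<dots> = (kill A ^^ Suc n) f x"
    by (simp add: funpow_swap1)
  finally show ?case .
qed

text \<open>A larger starting point can survive where a smaller one is killed; nonnegativity of
  \<open>f\<close> on the half line makes this extra contribution harmless.\<close>

lemma mono_kill:
  assumes lin: "linear_growth f" and mono: "mono f" and nonneg: "\<And>y. y \<ge> 0 \<Longrightarrow> f y \<ge> 0"
  shows "mono (kill {0..} f)"
proof (rule monoI)
  fix x y :: real assume "x \<le> y"
  show "kill {0..} f x \<le> kill {0..} f y"
    unfolding kill_def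
  proof (intro integral_mono integrable_kill lin)
    fix t
    show "indicator {0..} (x + t) * f (x + t) \<le> indicator {0..} (y + t) * f (y + t)"
      using \<open>x \<le> y\<close> monoD[OF mono, of "x + t" "y + t"] nonneg[of "y + t"]
      by (auto simp: indicator_def)
  qed auto
qed

lemma kill_nonneg:
  assumes "\<And>y. y \<in> A \<Longrightarrow> f y \<ge> 0"
  shows "kill A f x \<ge> 0"
  unfolding kill_def using assms by (intro Bochner_Integration.integral_nonneg) (auto simp: indicator_def)

section \<open>Survival probabilities and means of the killed walk\<close>

definition survival :: "nat \<Rightarrow> real \<Rightarrow> real" where
  "survival n = (kill {0..} ^^ n) (\<lambda>_. 1)"

text \<open>For \<open>n \<ge> 1\<close> this is E (x + S_n; tau_x > n). Starting from
  \<open>max 0\<close> instead of the identity matters only at \<open>n = 0\<close>: all terms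
  become nonnegative, and convexity makes the sequence increase from its first term.\<close>

definition killed_mean :: "nat \<Rightarrow> real \<Rightarrow> real" where
  "killed_mean n = (kill {0..} ^^ n) (max 0)"

lemma survival_0 [simp]: "survival 0 x = 1"
  and survival_Suc: "survival (Suc n) = kill {0..} (survival n)"
  unfolding survival_def by simp_all

lemma killed_mean_0 [simp]: "killed_mean 0 = max 0"
  and killed_mean_Suc: "killed_mean (Suc n) = kill {0..} (killed_mean n)"
  unfolding killed_mean_def by simp_all

lemma linear_growth_pos_part [simp]: "linear_growth (max 0)"
  by (rule linear_growthI[of _ 1]) (auto simp: max_def)

lemma linear_growth_survival: "linear_growth (survival n)"
  unfolding survival_def by (rule linear_growth_kill_pow) auto

lemma linear_growth_killed_mean: "linear_growth (killed_mean n)"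
  unfolding killed_mean_def by (rule linear_growth_kill_pow) auto

lemma survival_nonneg: "0 \<le> survival n x"
  by (induction n arbitrary: x) (auto simp: survival_Suc intro: kill_nonneg)

lemma killed_mean_nonneg: "0 \<le> killed_mean n x"
  by (induction n arbitrary: x) (auto simp: killed_mean_Suc intro: kill_nonneg)

lemma mono_survival: "mono (survival n)"
proof (induction n)
  case 0 then show ?case by (simp add: mono_def)
next
  case (Suc n) then show ?case
    unfolding survival_Suc by (intro mono_kill linear_growth_survival survival_nonneg)
qed

lemma mono_killed_mean: "mono (killed_mean n)"
proof (induction n)
  case 0 then show ?case by (auto simp: mono_def)
next
  case (Suc n) then show ?case
    unfolding killed_mean_Suc by (intro mono_kill linear_growth_killed_mean killed_mean_nonneg)
qed

lemma survival_Suc_le: "survival (Suc n) x \<le> survival n x"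
proof (induction n arbitrary: x)
  case 0
  have "kill {0..} (\<lambda>_. 1) x \<le> (\<integral>t. 1 \<partial>\<mu>)"
    unfolding kill_def using integrable_kill[of "\<lambda>_. 1" "{0..}" x]
    by (intro integral_mono) (auto simp: indicator_def)
  also have "\<dots> = 1" using \<mu>.prob_space by simp
  finally show ?case by (simp add: survival_def)
next
  case (Suc n)
  then show ?case
    unfolding survival_Suc[of "Suc n"] survival_Suc[of n]
    by (intro kill_mono linear_growth_kill linear_growth_survival) (auto simp: survival_Suc)
qed

lemma antimono_survival: "m \<le> n \<Longrightarrow> survival n x \<le> survival m x"
  by (rule lift_Suc_antimono_le[of "\<lambda>n. survival n x"]) (auto intro: survival_Suc_le)

lemma survival_le_1: "survival n x \<le> 1"
  using antimono_survival[of 0 n x] by simp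

lemma less_exit_time_iff: "enat n < exit_time X x \<omega> \<longleftrightarrow> (\<forall>k\<in>{1..n}. 0 \<le> x + walk X k \<omega>)"
proof
  assume *: "enat n < exit_time X x \<omega>"
  show "\<forall>k\<in>{1..n}. 0 \<le> x + walk X k \<omega>"
  proof (rule ballI, rule ccontr)
    fix k assume k: "k \<in> {1..n}" "\<not> 0 \<le> x + walk X k \<omega>"
    then have "exit_time X x \<omega> \<le> enat k"
      unfolding exit_time_def by (intro Inf_lower) auto
    then show False using * k by (metis atLeastAtMost_iff enat_ord_simps(1) leD order_trans)
  qed
next
  assume *: "\<forall>k\<in>{1..n}. 0 \<le> x + walk X k \<omega>"
  have "enat (Suc n) \<le> exit_time X x \<omega>"
    unfolding exit_time_def
  proof (rule Inf_greatest)
    fix z assume "z \<in> enat ` {k. 1 \<le> k \<and> x + walk X k \<omega> < 0}"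
    then obtain k where k: "z = enat k" "1 \<le> k" "x + walk X k \<omega> < 0" by auto
    with * have "\<not> k \<le> n" by force
    then show "enat (Suc n) \<le> z" using k by simp
  qed
  then show "enat n < exit_time X x \<omega>"
    by (meson enat_ord_simps(2) lessI less_le_trans)
qed

lemma alive_half_line:
  "alive {0..} n x \<omega> = (if enat n < exit_time X x \<omega> then 1 else 0)"
  unfolding less_exit_time_iff alive_def
  by (auto simp: indicator_def intro!: prod.neutral)

lemma survival_eq_prob:
  "measure M {\<omega> \<in> space M. exit_time X x \<omega> > enat n} = survival n x"
proof -
  have "survival n x = (\<integral>\<omega>. alive {0..} n x \<omega> * 1 \<partial>M)"
    unfolding survival_def by (rule expectation_alive[symmetric]) auto
  also have "\<dots> = (\<integral>\<omega>. indicator {\<omega> \<in> space M. exit_time X x \<omega> > enat n} \<omega> \<partial>M)"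
    by (intro Bochner_Integration.integral_cong) (auto simp: alive_half_line)
  also have "\<dots> = measure M {\<omega> \<in> space M. exit_time X x \<omega> > enat n}"
    by (simp add: Int_absorb2 subset_eq)
  finally show ?thesis by simp
qed

end

section \<open>Superharmonic functions and the harmonic function of the killed walk\<close>

lemma powr_expansion:
  fixes p z w :: real
  assumes "z > 0" "w > 0" "w \<noteq> z"
  obtains s where "min z w < s" "s < max z w"
    "w powr p = z powr p + p * z powr (p - 1) * (w - z) + p * (p - 1) * s powr (p - 2) / 2 * (w - z)\<^sup>2"
proof -
  define diff where "diff m w = (if m = 0 then w powr p else if m = 1 then p * w powr (p - 1)
      else p * (p - 1) * w powr (p - 2))" for m :: nat and w :: real
  have "\<exists>t. (if w < z then w < t \<and> t < z else z < t \<and> t < w) \<and>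
      w powr p = (\<Sum>m<2. diff m z / fact m * (w - z) ^ m) + diff 2 t / fact 2 * (w - z) ^ 2"
  proof (rule Taylor[where a = "min z w" and b = "max z w"])
    show "\<forall>m t. m < 2 \<and> min z w \<le> t \<and> t \<le> max z w \<longrightarrow> DERIV (diff m) t :> diff (Suc m) t"
    proof (intro allI impI)
      fix m :: nat and t :: real
      assume *: "m < 2 \<and> min z w \<le> t \<and> t \<le> max z w"
      then have "t > 0" using assms by (auto simp: min_def split: if_splits)
      from * consider "m = 0" | "m = 1" by linarith
      then show "DERIV (diff m) t :> diff (Suc m) t"
      proof cases
        case 1
        have "((\<lambda>w. w powr p) has_real_derivative p * t powr (p - 1)) (at t)"
          using \<open>t > 0\<close> by (rule has_real_derivative_powr)
        then show ?thesis unfolding diff_def 1 by simp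
      next
        case 2
        have "((\<lambda>w. p * w powr (p - 1)) has_real_derivative p * ((p - 1) * t powr (p - 1 - 1))) (at t)"
          using has_real_derivative_powr[OF \<open>t > 0\<close>, of "p - 1"] by (rule DERIV_cmult)
        then show ?thesis unfolding diff_def 2 by (simp add: mult.assoc)
      qed
    qed
  qed (use assms in \<open>auto simp: diff_def\<close>)
  then obtain t where t: "if w < z then w < t \<and> t < z else z < t \<and> t < w"
    and eq: "w powr p = (\<Sum>m<2. diff m z / fact m * (w - z) ^ m) + diff 2 t / fact 2 * (w - z) ^ 2"
    by blast
  show ?thesis
  proof (rule that[of t])
    show "min z w < t" "t < max z w" using t assms(3) by (auto split: if_splits)
    show "w powr p = z powr p + p * z powr (p - 1) * (w - z) + p * (p - 1) * t powr (p - 2) / 2 * (w - z)\<^sup>2"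
      using eq by (simp add: diff_def numeral_2_eq_2)
  qed
qed

lemma powr_le_tangent:
  fixes p z w :: real
  assumes "0 < p" "p < 1" "z > 0" "w > 0"
  shows "w powr p \<le> z powr p + p * z powr (p - 1) * (w - z)"
proof (cases "w = z")
  case False
  then obtain s where "w powr p = z powr p + p * z powr (p - 1) * (w - z) + p * (p - 1) * s powr (p - 2) / 2 * (w - z)\<^sup>2"
    using powr_expansion[of z w p] assms by metis
  moreover have "p * (p - 1) * s powr (p - 2) / 2 * (w - z)\<^sup>2 \<le> 0"
    using assms by (intro mult_nonpos_nonneg divide_nonpos_nonneg mult_nonneg_nonpos[of p]) auto
  ultimately show ?thesis by linarith
qed simp

text \<open>The intermediate point of the Taylor expansion lies below
  \<open>z + t \<le> 2 * z\<close>, and \<open>s powr (p - 2)\<close> decreases in \<open>s\<close>;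
  this is the origin of the factor \<open>2 powr (p - 2)\<close>.\<close>

lemma powr_le_quadratic:
  fixes p z t :: real
  assumes "0 < p" "p < 1" "0 \<le> t" "t \<le> z" "0 < z"
  shows "(z + t) powr p \<le> z powr p + p * z powr (p - 1) * t
      - p * (1 - p) * 2 powr (p - 2) / 2 * z powr (p - 2) * t\<^sup>2"
proof (cases "t = 0")
  case False
  then obtain s where s: "s > z" "s < z + t"
    and eq: "(z + t) powr p = z powr p + p * z powr (p - 1) * t + p * (p - 1) * s powr (p - 2) / 2 * t\<^sup>2"
    using powr_expansion[of z "z + t" p] assms by (auto simp: min_def max_def)
  have "2 powr (p - 2) * z powr (p - 2) = (2 * z) powr (p - 2)"
    using assms by (simp add: powr_mult)
  also have "\<dots> \<le> s powr (p - 2)"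
    using assms s by (intro powr_mono2') auto
  finally have "p * (1 - p) / 2 * t\<^sup>2 * (2 powr (p - 2) * z powr (p - 2)) \<le> p * (1 - p) / 2 * t\<^sup>2 * s powr (p - 2)"
    using assms by (intro mult_left_mono) auto
  then have "p * (p - 1) * s powr (p - 2) / 2 * t\<^sup>2 \<le> - (p * (1 - p) / 2 * t\<^sup>2 * (2 powr (p - 2) * z powr (p - 2)))"
    by (simp add: algebra_simps)
  also have "\<dots> = - (p * (1 - p) * 2 powr (p - 2) / 2 * z powr (p - 2) * t\<^sup>2)"
    by simp
  finally show ?thesis unfolding eq by linarith
qed simp

text \<open>The bound \<open>\<delta> < 1\<close> keeps the exponent \<open>1 - \<delta>\<close> of
  the concave power strictly between 0 and 1; a larger \<delta> is lowered before the locale is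
  entered.\<close>

locale centred_walk = random_walk +
  fixes \<sigma> \<delta> :: real
  assumes mean_0: "(\<integral>\<omega>. X 1 \<omega> \<partial>M) = 0"
    and variance: "(\<integral>\<omega>. (X 1 \<omega>)\<^sup>2 \<partial>M) = \<sigma>\<^sup>2"
    and \<sigma>_pos: "\<sigma> > 0"
    and \<delta>: "0 < \<delta>" "\<delta> < 1"
    and moment: "integrable M (\<lambda>\<omega>. \<bar>X 1 \<omega>\<bar> powr (2 + \<delta>))"
begin

lemma X1_measurable [measurable]: "X 1 \<in> borel_measurable M"
  by (rule X_measurable) simp

lemma \<mu>_mean: "(\<integral>t. t \<partial>\<mu>) = 0"
  unfolding \<mu>_def using mean_0 integral_distr[OF X1_measurable, of "\<lambda>t. t"] by simp

lemma \<mu>_second: "(\<integral>t. t\<^sup>2 \<partial>\<mu>) = \<sigma>\<^sup>2"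
  unfolding \<mu>_def using variance integral_distr[OF X1_measurable, of "\<lambda>t. t\<^sup>2"] by simp

text \<open>The integral of a function that is not integrable has the value 0, so a positive
  variance forces integrability.\<close>

lemma integrable_square: "integrable \<mu> (\<lambda>t. t\<^sup>2)"
proof (rule ccontr)
  assume "\<not> integrable \<mu> (\<lambda>t. t\<^sup>2)"
  then have "(\<integral>t. t\<^sup>2 \<partial>\<mu>) = 0" by (rule not_integrable_integral_eq)
  then show False using \<mu>_second \<sigma>_pos by simp
qed

lemma integrable_moment: "integrable \<mu> (\<lambda>t. \<bar>t\<bar> powr (2 + \<delta>))"
proof -
  have m: "(\<lambda>t::real. \<bar>t\<bar> powr (2 + \<delta>)) \<in> borel_measurable borel" by measurable
  show ?thesis unfolding \<mu>_def integrable_distr_eq[OF X1_measurable m] by (rule moment)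
qed

definition abs_moment :: real where "abs_moment = (\<integral>t. \<bar>t\<bar> powr (2 + \<delta>) \<partial>\<mu>)"

lemma abs_moment_nonneg: "abs_moment \<ge> 0"
  unfolding abs_moment_def by simp

lemma integrable_indicator_mult:
  fixes f :: "real \<Rightarrow> real"
  assumes "integrable \<mu> f" and [measurable]: "A \<in> sets borel"
  shows "integrable \<mu> (\<lambda>t. f t * indicator A t)"
  using integrable_mult_indicator[of A \<mu> f] assms by (simp add: mult.commute)

text \<open>Markov's inequality in the form \<open>\<bar>t\<bar> \<le> \<bar>t\<bar> powr (2 +
  \<delta>) * c powr - (1 + \<delta>)\<close> wherever \<open>c \<le> \<bar>t\<bar>\<close>.\<close>

lemma tail_mean_le:
  assumes "c > 0"
  shows "(\<integral>t. \<bar>t\<bar> * indicator {t. c \<le> \<bar>t\<bar>} t \<partial>\<mu>) \<le> abs_moment * c powr - (1 + \<delta>)"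
proof -
  have "(\<integral>t. \<bar>t\<bar> * indicator {t. c \<le> \<bar>t\<bar>} t \<partial>\<mu>) \<le> (\<integral>t. \<bar>t\<bar> powr (2 + \<delta>) * c powr - (1 + \<delta>) \<partial>\<mu>)"
  proof (rule integral_mono)
    show "integrable \<mu> (\<lambda>t. \<bar>t\<bar> * indicator {t. c \<le> \<bar>t\<bar>} t)"
      by (intro integrable_indicator_mult integrable_abs integrable_id) measurable
    show "integrable \<mu> (\<lambda>t. \<bar>t\<bar> powr (2 + \<delta>) * c powr - (1 + \<delta>))"
      using integrable_moment by auto
    fix t :: real
    show "\<bar>t\<bar> * indicator {t. c \<le> \<bar>t\<bar>} t \<le> \<bar>t\<bar> powr (2 + \<delta>) * c powr - (1 + \<delta>)"
    proof (cases "c \<le> \<bar>t\<bar>")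
      case True
      then have "\<bar>t\<bar> > 0" using assms by linarith
      have "\<bar>t\<bar> * c powr (1 + \<delta>) \<le> \<bar>t\<bar> * \<bar>t\<bar> powr (1 + \<delta>)"
        using True assms \<delta> by (intro mult_left_mono powr_mono2) auto
      also have "\<dots> = \<bar>t\<bar> powr (1 + (1 + \<delta>))"
        using \<open>\<bar>t\<bar> > 0\<close> by (simp only: powr_add powr_one)
      finally have "\<bar>t\<bar> * c powr (1 + \<delta>) \<le> \<bar>t\<bar> powr (2 + \<delta>)" by simp
      then have "\<bar>t\<bar> \<le> \<bar>t\<bar> powr (2 + \<delta>) / c powr (1 + \<delta>)"
        using assms by (simp add: pos_le_divide_eq)
      then show ?thesis using True by (simp only: powr_minus_divide) simp
    qed auto
  qed
  also have "\<dots> = abs_moment * c powr - (1 + \<delta>)" by (simp add: abs_moment_def)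
  finally show ?thesis .
qed

text \<open>Otherwise the step would be almost surely nonpositive, and mean zero would make it
  vanish, against the positive variance. The truncated upward second moment is what concave and
  quadratic test functions gain per step.\<close>

lemma ex_positive_part: "\<exists>b\<ge>1. (\<integral>t. t\<^sup>2 * indicator {0..b} t \<partial>\<mu>) > 0"
proof (rule ccontr)
  assume *: "\<not> ?thesis"
  have int: "integrable \<mu> (\<lambda>t. t\<^sup>2 * indicator {0..b} t)" for b :: real
    by (rule integrable_indicator_mult[OF integrable_square]) simp
  have "AE t in \<mu>. t\<^sup>2 * indicator {0..real (Suc n)} t = 0" for n
  proof -
    have "(\<integral>t. t\<^sup>2 * indicator {0..real (Suc n)} t \<partial>\<mu>) \<ge> 0" by (rule Bochner_Integration.integral_nonneg) simp
    moreover have "\<not> (\<integral>t. t\<^sup>2 * indicator {0..real (Suc n)} t \<partial>\<mu>) > 0" 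
    proof -
      have "real (Suc n) \<ge> 1" by simp
      then show ?thesis using * by blast
    qed
    ultimately have "(\<integral>t. t\<^sup>2 * indicator {0..real (Suc n)} t \<partial>\<mu>) = 0" by linarith
    then show ?thesis using integral_nonneg_eq_0_iff_AE[OF int] by simp
  qed
  then have "AE t in \<mu>. \<forall>n. t\<^sup>2 * indicator {0..real (Suc n)} t = 0"
    unfolding AE_all_countable by (rule allI)
  then have le: "AE t in \<mu>. t \<le> 0"
  proof (rule AE_mp, intro AE_I2 impI)
    fix t :: real assume h: "\<forall>n. t\<^sup>2 * indicator {0..real (Suc n)} t = 0"
    obtain n where "t \<le> real n" using real_arch_simple by blast
    then show "t \<le> 0" using h[rule_format, of n] by (cases "0 \<le> t") auto
  qed
  have "AE t in \<mu>. - t = 0"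
    by (subst integral_nonneg_eq_0_iff_AE[symmetric]) (use le integrable_id \<mu>_mean in auto)
  then have "(\<integral>t. t\<^sup>2 \<partial>\<mu>) = (\<integral>t. 0 \<partial>\<mu>)"
    by (intro integral_cong_AE) auto
  then show False using \<mu>_second \<sigma>_pos by simp
qed

lemma linear_growth_majorant:
  assumes A: "A \<ge> 1" and C: "C > 0"
  shows "linear_growth (\<lambda>y. y + C * (A + \<bar>y\<bar>) powr (1 - \<delta>))"
proof (rule linear_growthI[of _ "1 + C * A"])
  fix y :: real
  have "(A + \<bar>y\<bar>) powr (1 - \<delta>) \<le> (A + \<bar>y\<bar>) powr 1" using A \<delta> by (intro powr_mono) auto
  also have "\<dots> = A + \<bar>y\<bar>" using A by simp
  also have "\<dots> \<le> A * (1 + \<bar>y\<bar>)" using mult_right_mono[OF A abs_ge_zero[of y]] by (simp add: algebra_simps)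
  finally have "C * (A + \<bar>y\<bar>) powr (1 - \<delta>) \<le> C * (A * (1 + \<bar>y\<bar>))" using C by (intro mult_left_mono) auto
  moreover have "\<bar>y + C * (A + \<bar>y\<bar>) powr (1 - \<delta>)\<bar> \<le> \<bar>y\<bar> + C * (A + \<bar>y\<bar>) powr (1 - \<delta>)"
    using C by (intro order_trans[OF abs_triangle_ineq]) simp
  ultimately show "\<bar>y + C * (A + \<bar>y\<bar>) powr (1 - \<delta>)\<bar> \<le> (1 + C * A) * (1 + \<bar>y\<bar>)"
    by (simp add: algebra_simps)
qed measurable

text \<open>A concave power added to the identity is superharmonic for the killed walk: the second-order
  gain of order \<open>z\<^sup>-\<^sup>1\<^sup>-\<^sup>\<delta>\<close> from concavity pays for the mean undershoot, which the
  moment of order \<open>2 + \<delta>\<close> makes of the same order.\<close>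

lemma superharmonic_majorant:
  "\<exists>A\<ge>1. \<exists>C>0. \<forall>y\<ge>0. kill {0..} (\<lambda>y. y + C * (A + \<bar>y\<bar>) powr (1 - \<delta>)) y \<le> y + C * (A + y) powr (1 - \<delta>)"
proof -
  obtain b where b: "b \<ge> 1" and s_pos: "(\<integral>t. t\<^sup>2 * indicator {0..b} t \<partial>\<mu>) > 0"
    using ex_positive_part by blast
  define s where "s = (\<integral>t. t\<^sup>2 * indicator {0..b} t \<partial>\<mu>)"
  define p where "p = 1 - \<delta>"
  have p: "0 < p" "p < 1" using \<delta> by (auto simp: p_def)
  \<comment> \<open>\<open>c\<close> is the curvature constant of \<open>powr_le_quadratic\<close>.
    \<open>K'\<close> is the constant left when the tail bound at level \<open>z / 2\<close> is
    written as a multiple of \<open>z powr (p - 2)\<close>, which equals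
    \<open>z powr - (1 + \<delta>)\<close>.\<close>
  define c where "c = p * (1 - p) * 2 powr (p - 2) / 2"
  have c: "c > 0" unfolding c_def using p by simp
  define K' where "K' = abs_moment * 2 powr (1 + \<delta>)"
  have K': "K' \<ge> 0" unfolding K'_def using abs_moment_nonneg by simp
  have s: "s > 0" using s_pos s_def by simp
  have "((\<lambda>A. p * K' * A powr (-\<delta>)) \<longlongrightarrow> p * K' * 0) at_top"
    using \<delta> by (intro tendsto_intros tendsto_neg_powr filterlim_ident) auto
  then have "eventually (\<lambda>A. p * K' * A powr (-\<delta>) < c * s / 2) at_top"
    using c s by (intro order_tendstoD(2)) auto
  then obtain A0 where A0: "\<And>A. A \<ge> A0 \<Longrightarrow> p * K' * A powr (-\<delta>) < c * s / 2"
    unfolding eventually_at_top_linorder by blast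
  \<comment> \<open>\<open>A0\<close> makes the tail mean, weighted by the slope of the power, cost
    at most half of the concave gain. \<open>2 * b\<close> keeps jumps in \<open>{0..b}\<close>
    below \<open>z\<close>, as the quadratic bound requires.\<close>
  define A where "A = max A0 (2 * b)"
  have A: "A \<ge> A0" "A \<ge> 2 * b" "A \<ge> 1" using b by (auto simp: A_def)
  \<comment> \<open>The first entry gives \<open>z \<le> C * z powr p\<close> for
    \<open>z \<le> 2 * A\<close>; the second lets the other half of the gain pay for the tail mean
    of the identity part.\<close>
  define C where "C = max ((2 * A) powr \<delta>) (2 * K' / (c * s))"
  have C: "C \<ge> (2 * A) powr \<delta>" "C \<ge> 2 * K' / (c * s)" by (auto simp: C_def)
  have "(2 * A) powr \<delta> > 0" using A by simp
  then have C0: "C > 0" using C(1) by linarith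
  have "kill {0..} (\<lambda>y. y + C * (A + \<bar>y\<bar>) powr p) y \<le> y + C * (A + y) powr p" if y: "y \<ge> 0" for y
  proof -
    define z where "z = A + y"
    have z: "z \<ge> A" "z > 0" "z \<ge> 1" using y A by (auto simp: z_def)
    let ?D = "p * z powr (p - 1)"
    have D: "?D \<ge> 0" using p by simp
    have CD: "1 + C * ?D \<ge> 0"
      using mult_nonneg_nonneg[OF less_imp_le[OF C0] D] by linarith
    \<comment> \<open>A bound for the integrand at every \<open>t\<close>: the tangent, minus the
      quadratic gain from moderate upward jumps, plus a tail term that makes up for negative values
      of the tangent where the walk is killed. The linear terms integrate to 0.\<close>
    define rhs where "rhs t = y + t + C * z powr p + C * ?D * t + (1 + C * ?D) * (\<bar>t\<bar> * indicator {t. z / 2 \<le> \<bar>t\<bar>} t)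
        - C * c * z powr (p - 2) * (t\<^sup>2 * indicator {0..b} t)" for t
    have int1: "integrable \<mu> (\<lambda>t. \<bar>t\<bar> * indicator {t. z / 2 \<le> \<bar>t\<bar>} t)"
      by (intro integrable_indicator_mult integrable_abs integrable_id) measurable
    have int2: "integrable \<mu> (\<lambda>t. t\<^sup>2 * indicator {0..b} t)"
      by (intro integrable_indicator_mult integrable_square) measurable
    have pw: "indicator {0..} (y + t) * (y + t + C * (A + \<bar>y + t\<bar>) powr p) \<le> rhs t" for t
    proof -
      consider "0 \<le> y + t" "0 \<le> t" "t \<le> b" | "0 \<le> y + t" "\<not> (0 \<le> t \<and> t \<le> b)" | "y + t < 0" by linarith
      then show ?thesis
      proof cases
        case 1
        have *: "(z + t) powr p \<le> z powr p + ?D * t - c * z powr (p - 2) * t\<^sup>2"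
          unfolding c_def by (rule powr_le_quadratic) (use 1 p z A b in auto)
        have "C * (z + t) powr p \<le> C * (z powr p + ?D * t - c * z powr (p - 2) * t\<^sup>2)"
          using C0 by (intro mult_left_mono *) auto
        moreover have "0 \<le> (1 + C * ?D) * (\<bar>t\<bar> * indicator {t. z / 2 \<le> \<bar>t\<bar>} t)"
          by (intro mult_nonneg_nonneg[OF CD]) simp
        moreover have e: "A + \<bar>y + t\<bar> = z + t" using 1 by (simp add: z_def)
        ultimately show ?thesis using 1 unfolding rhs_def e by (simp add: algebra_simps)
      next
        case 2
        then have zt: "z + t > 0" using A by (simp add: z_def)
        have *: "(z + t) powr p \<le> z powr p + ?D * t"
          using powr_le_tangent[OF p z(2) zt] by simp
        have "C * (z + t) powr p \<le> C * (z powr p + ?D * t)"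
          using C0 by (intro mult_left_mono *) auto
        moreover have "0 \<le> (1 + C * ?D) * (\<bar>t\<bar> * indicator {t. z / 2 \<le> \<bar>t\<bar>} t)"
          by (intro mult_nonneg_nonneg[OF CD]) simp
        moreover have e: "A + \<bar>y + t\<bar> = z + t" using 2 by (simp add: z_def)
        moreover have "indicator {0..b} t = (0::real)" using 2 by (auto simp: indicator_def)
        ultimately show ?thesis using 2 unfolding rhs_def e by (simp add: algebra_simps)
      next
        case 3
        then have t: "t < 0" using y by linarith
        have i: "indicator {0..b} t = (0::real)" using t by simp
        \<comment> \<open>On a killed step the integrand is 0. For
          \<open>z / 2 \<le> \<bar>t\<bar>\<close> the tail term cancels the linear terms exactly; a
          smaller jump leaves the half line only if \<open>z \<le> 2 * A\<close>, and there
          \<open>z \<le> C * z powr p\<close> suffices.\<close>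
        have "rhs t \<ge> 0"
        proof (cases "z / 2 \<le> \<bar>t\<bar>")
          case True
          then have "rhs t = y + C * z powr p" unfolding rhs_def i using t by (simp add: algebra_simps)
          then show ?thesis using y C0 by simp
        next
          case False
          then have t2: "t > - (z / 2)" using t by linarith
          from 3 t2 have "y \<le> A" unfolding z_def by argo
          then have "z \<le> 2 * A" by (simp add: z_def)
          have "z = z powr p * z powr \<delta>" using z by (simp add: powr_add[symmetric] p_def)
          also have "\<dots> \<le> z powr p * C"
            using C(1) z \<open>z \<le> 2 * A\<close> \<delta> by (intro mult_left_mono order_trans[OF _ C(1)] powr_mono2) auto
          finally have zC: "z \<le> C * z powr p" by (simp add: mult.commute)
          have "?D * t \<ge> ?D * - (z / 2)" using t2 D by (intro mult_left_mono) auto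
          also have "?D * - (z / 2) = - (p / 2) * (z powr (p - 1) * z powr 1)" using z by simp
          also have "\<dots> = - (p / 2) * z powr p" unfolding powr_add[symmetric] by simp
          also have "\<dots> \<ge> - (1 / 2) * z powr p" using p by (intro mult_right_mono) auto
          finally have "C * (?D * t) \<ge> C * (- (1 / 2) * z powr p)" using C0 by (intro mult_left_mono) auto
          then have "rhs t \<ge> y + t + C * z powr p / 2" unfolding rhs_def i using False by (simp add: mult.assoc)
          then show ?thesis using zC t2 y by linarith
        qed
        then show ?thesis using 3 by simp
      qed
    qed
    have int_rhs: "integrable \<mu> rhs"
      unfolding rhs_def[abs_def] by (intro Bochner_Integration.integrable_add Bochner_Integration.integrable_diff integrable_mult_right integrable_id int1 int2 \<mu>.integrable_const)
    have lin: "linear_growth (\<lambda>y. y + C * (A + \<bar>y\<bar>) powr p)"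
      unfolding p_def by (rule linear_growth_majorant[OF A(3) C0])
    have "kill {0..} (\<lambda>y. y + C * (A + \<bar>y\<bar>) powr p) y \<le> (\<integral>t. rhs t \<partial>\<mu>)"
      unfolding kill_def by (intro integral_mono integrable_kill[OF lin] int_rhs pw) auto
    also have "\<dots> = y + C * z powr p + (1 + C * ?D) * (\<integral>t. \<bar>t\<bar> * indicator {t. z / 2 \<le> \<bar>t\<bar>} t \<partial>\<mu>)
        - C * c * z powr (p - 2) * s"
      unfolding rhs_def s_def using int1 int2 integrable_id \<mu>_mean \<mu>.prob_space by simp
    also have "\<dots> \<le> y + C * z powr p"
    proof -
      have "(1 + C * ?D) * (\<integral>t. \<bar>t\<bar> * indicator {t. z / 2 \<le> \<bar>t\<bar>} t \<partial>\<mu>) \<le> (1 + C * ?D) * (abs_moment * (z / 2) powr - (1 + \<delta>))"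
        using z by (intro mult_left_mono tail_mean_le CD) auto
      also have "abs_moment * (z / 2) powr - (1 + \<delta>) = K' * z powr (p - 2)"
        unfolding K'_def using z by (simp add: powr_divide powr_minus p_def field_simps powr_diff powr_add)
      also have "(1 + C * ?D) * (K' * z powr (p - 2)) = (K' + C * (p * K' * z powr - \<delta>)) * z powr (p - 2)"
        by (simp add: p_def algebra_simps)
      also have "\<dots> \<le> (C * (c * s) / 2 + C * (c * s / 2)) * z powr (p - 2)"
      proof (intro mult_right_mono add_mono mult_left_mono)
        show "K' \<le> C * (c * s) / 2" using C(2) c s by (simp add: field_simps)
        show "p * K' * z powr - \<delta> \<le> c * s / 2" using A0[of z] z A by simp
      qed (use C0 in auto)
      finally show ?thesis by (simp add: algebra_simps)
    qed
    finally show ?thesis unfolding z_def .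
  qed
  then show ?thesis unfolding p_def using A(3) C0 by blast
qed

section \<open>The harmonic function as a monotone limit\<close>

lemma killed_mean_0_le_1: "max 0 x \<le> kill {0..} (max 0) x"
proof -
  have "max 0 x \<le> (\<integral>t. max 0 (x + t) \<partial>\<mu>)"
  proof -
    have i: "integrable \<mu> (\<lambda>t. max 0 (x + t))" by (rule integrable_linear_growth) simp
    \<comment> \<open>Jensen's inequality for the convex function \<open>max 0\<close> and a centred
      step; killing then costs nothing, since \<open>max 0\<close> vanishes below zero.\<close>
    have "x = (\<integral>t. x + t \<partial>\<mu>)" using integrable_id \<mu>_mean \<mu>.prob_space by simp
    also have "\<dots> \<le> (\<integral>t. max 0 (x + t) \<partial>\<mu>)"
      using integrable_id i by (intro integral_mono) auto
    finally show ?thesis by simp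
  qed
  also have "\<dots> = kill {0..} (max 0) x"
    unfolding kill_def by (intro Bochner_Integration.integral_cong) (auto simp: indicator_def max_def)
  finally show ?thesis .
qed

lemma killed_mean_Suc_ge: "killed_mean n x \<le> killed_mean (Suc n) x"
proof (induction n arbitrary: x)
  case 0
  then show ?case using killed_mean_0_le_1 by (simp add: killed_mean_Suc)
next
  case (Suc n)
  then show ?case
    unfolding killed_mean_Suc[of "Suc n"] killed_mean_Suc[of n]
    by (intro kill_mono linear_growth_kill linear_growth_killed_mean) (auto simp: killed_mean_Suc)
qed

text \<open>The candidate for \<open>V\<close>, defined on the whole line. The supremum is also the
  limit, because the sequence is increasing and bounded.\<close>

definition renewal :: "real \<Rightarrow> real" where "renewal x = (SUP n. killed_mean n x)"

text \<open>The superharmonic majorant dominates \<open>max 0\<close> on the half line, and each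
  application of the operator preserves the domination; the bound is therefore uniform in
  \<open>n\<close>.\<close>

lemma killed_mean_bound:
  "\<exists>A\<ge>1. \<exists>C>0. \<forall>n. \<forall>y\<ge>0. killed_mean n y \<le> y + C * (A + y) powr (1 - \<delta>)"
proof -
  obtain A C where A: "A \<ge> 1" and C: "C > 0"
    and sup: "\<And>y. y \<ge> 0 \<Longrightarrow> kill {0..} (\<lambda>y. y + C * (A + \<bar>y\<bar>) powr (1 - \<delta>)) y \<le> y + C * (A + y) powr (1 - \<delta>)"
    using superharmonic_majorant by blast
  note lin = linear_growth_majorant[OF A C]
  have "killed_mean n y \<le> y + C * (A + y) powr (1 - \<delta>)" if "y \<ge> 0" for n y
    using that
  proof (induction n arbitrary: y)
    case 0
    then show ?case using C by simp
  next
    case (Suc n)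
    have "killed_mean (Suc n) y \<le> kill {0..} (\<lambda>y. y + C * (A + \<bar>y\<bar>) powr (1 - \<delta>)) y"
      unfolding killed_mean_Suc
      by (intro kill_mono linear_growth_killed_mean lin) (use Suc.IH in auto)
    then show ?case using sup[OF Suc.prems] by linarith
  qed
  then show ?thesis using A C by blast
qed

lemma bdd_above_killed_mean: "bdd_above (range (\<lambda>n. killed_mean n x))"
proof -
  obtain A C where "\<And>n y. y \<ge> 0 \<Longrightarrow> killed_mean n y \<le> y + C * (A + y) powr (1 - \<delta>)"
    using killed_mean_bound by blast
  then have "killed_mean n (max 0 x) \<le> max 0 x + C * (A + max 0 x) powr (1 - \<delta>)" for n by simp
  then have "killed_mean n x \<le> max 0 x + C * (A + max 0 x) powr (1 - \<delta>)" for n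
    using monoD[OF mono_killed_mean[of n], of x "max 0 x"] by (meson max.cobounded2 order_trans)
  then show ?thesis by (rule bdd_aboveI2)
qed

lemma killed_mean_le_renewal: "killed_mean n x \<le> renewal x"
  unfolding renewal_def by (intro cSUP_upper bdd_above_killed_mean) auto

lemma killed_mean_tendsto: "(\<lambda>n. killed_mean n x) \<longlonglongrightarrow> renewal x"
  unfolding renewal_def
  by (intro LIMSEQ_incseq_SUP bdd_above_killed_mean incseq_SucI killed_mean_Suc_ge)

lemma pos_part_le_renewal: "max 0 x \<le> renewal x"
  using killed_mean_le_renewal[of 0 x] by simp

lemma renewal_nonneg: "0 \<le> renewal x"
  using pos_part_le_renewal[of x] by simp

lemma mono_renewal: "mono renewal"
proof (rule monoI)
  fix x y :: real assume "x \<le> y"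
  then show "renewal x \<le> renewal y"
    unfolding renewal_def[of x]
    by (intro cSUP_least) (auto intro: order_trans[OF monoD[OF mono_killed_mean] killed_mean_le_renewal])
qed

lemma renewal_bound:
  "\<exists>A\<ge>1. \<exists>C>0. \<forall>y\<ge>0. renewal y \<le> y + C * (A + y) powr (1 - \<delta>)"
proof -
  obtain A C where AC: "A \<ge> 1" "C > 0" "\<And>n y. y \<ge> 0 \<Longrightarrow> killed_mean n y \<le> y + C * (A + y) powr (1 - \<delta>)"
    using killed_mean_bound by blast
  have "renewal y \<le> y + C * (A + y) powr (1 - \<delta>)" if "y \<ge> 0" for y
    unfolding renewal_def using AC(3)[OF that] by (intro cSUP_least) auto
  then show ?thesis using AC(1,2) by blast
qed

text \<open>The correction \<open>(A + y) powr (1 - \<delta>)\<close> is of smaller order than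
  \<open>y\<close>. Together with \<open>pos_part_le_renewal\<close> this gives the asymptotic
  equivalence of \<open>renewal y\<close> and \<open>y\<close>.\<close>

lemma renewal_le_asymp:
  assumes "e > 0" shows "\<exists>B>0. \<forall>y\<ge>B. renewal y \<le> (1 + e) * y"
proof -
  obtain A C where A: "A \<ge> 1" and C: "C > 0" and le: "\<And>y. y \<ge> 0 \<Longrightarrow> renewal y \<le> y + C * (A + y) powr (1 - \<delta>)"
    using renewal_bound by blast
  have "((\<lambda>y. C * (A + 1) * y powr (-\<delta>)) \<longlongrightarrow> C * (A + 1) * 0) at_top"
    using \<delta> by (intro tendsto_intros tendsto_neg_powr filterlim_ident) auto
  then have "eventually (\<lambda>y. C * (A + 1) * y powr (-\<delta>) < e) at_top"
    using assms by (intro order_tendstoD(2)) auto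
  then obtain B where B: "\<And>y. y \<ge> B \<Longrightarrow> C * (A + 1) * y powr (-\<delta>) < e"
    unfolding eventually_at_top_linorder by blast
  have "renewal y \<le> (1 + e) * y" if "y \<ge> max 1 B" for y
  proof -
    from that have y: "y \<ge> 1" "y \<ge> B" by auto
    have "(A + y) powr (1 - \<delta>) \<le> ((A + 1) * y) powr (1 - \<delta>)"
      using A y \<delta> mult_left_mono[of 1 y A] by (intro powr_mono2) (auto simp: algebra_simps)
    also have "\<dots> = (A + 1) powr (1 - \<delta>) * (y powr 1 * y powr - \<delta>)"
      unfolding powr_add[symmetric] using A y by (simp add: powr_mult)
    also have "\<dots> \<le> (A + 1) powr 1 * (y powr 1 * y powr - \<delta>)"
      using A y \<delta> by (intro mult_right_mono powr_mono) auto
    finally have "(A + y) powr (1 - \<delta>) \<le> (A + 1) * (y * y powr - \<delta>)" using A y by simp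
    then have "C * (A + y) powr (1 - \<delta>) \<le> C * ((A + 1) * (y * y powr - \<delta>))"
      using C by (intro mult_left_mono) auto
    also have "\<dots> = (C * (A + 1) * y powr (-\<delta>)) * y" by simp
    also have "\<dots> \<le> e * y" using B[OF y(2)] y by (intro mult_right_mono) auto
    finally show ?thesis using le[of y] y by (simp add: algebra_simps)
  qed
  moreover have "max 1 B > 0" by simp
  ultimately show ?thesis by blast
qed

lemma linear_growth_renewal: "linear_growth renewal"
proof -
  obtain B where B: "B > 0" "\<And>y. y \<ge> B \<Longrightarrow> renewal y \<le> 2 * y"
    using renewal_le_asymp[of 1] by auto
  show ?thesis
  proof (rule linear_growthI[of _ "2 + renewal B"])
    show "renewal \<in> borel_measurable borel" by (rule borel_measurable_mono[OF mono_renewal])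
    fix y :: real
    have *: "\<bar>renewal y\<bar> = renewal y" using renewal_nonneg by simp
    have 0: "(2 + renewal B) * (1 + \<bar>y\<bar>) = 2 + 2 * \<bar>y\<bar> + renewal B + renewal B * \<bar>y\<bar>" "renewal B * \<bar>y\<bar> \<ge> 0"
      using renewal_nonneg by (simp_all add: algebra_simps)
    show "\<bar>renewal y\<bar> \<le> (2 + renewal B) * (1 + \<bar>y\<bar>)"
    proof (cases "y \<ge> B")
      case True
      then show ?thesis unfolding * 0(1) using B(2)[OF True] B(1) 0(2) renewal_nonneg[of B] abs_ge_self[of y] by linarith
    next
      case False
      then show ?thesis using monoD[OF mono_renewal, of y B] 0 unfolding * by linarith
    qed
  qed
qed

lemma renewal_le_linear: "\<exists>c>0. \<forall>y\<ge>1. renewal y \<le> c * y"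
proof -
  obtain c where c: "c \<ge> 0" "\<And>y. \<bar>renewal y\<bar> \<le> c * (1 + \<bar>y\<bar>)"
    using linear_growth_bound[OF linear_growth_renewal] by blast
  have "renewal y \<le> (2 * c + 1) * y" if "y \<ge> 1" for y
  proof -
    have "renewal y \<le> c * (1 + y)" using c(2)[of y] that by simp
    also have "\<dots> \<le> c * (2 * y)" using that c by (intro mult_left_mono) auto
    also have "\<dots> \<le> (2 * c + 1) * y" using that by (simp add: algebra_simps)
    finally show ?thesis .
  qed
  then show ?thesis using c(1) by (intro exI[of _ "2 * c + 1"]) auto
qed

text \<open>The recursion of \<open>killed_mean\<close> passes to the limit, with
  \<open>renewal\<close> itself as the dominating function. The identity holds for every real
  starting point, also below zero.\<close>

lemma kill_renewal: "kill {0..} renewal x = renewal x"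
proof -
  have "(\<lambda>n. kill {0..} (killed_mean n) x) \<longlonglongrightarrow> kill {0..} renewal x"
    unfolding kill_def
  proof (rule integral_dominated_convergence[where w = "\<lambda>t. indicator {0..} (x + t) * renewal (x + t)"])
    note [measurable] = linear_growth_measurable[OF linear_growth_killed_mean] linear_growth_measurable[OF linear_growth_renewal]
    show "(\<lambda>t. indicator {0..} (x + t) * renewal (x + t)) \<in> borel_measurable \<mu>" by measurable
    show "(\<lambda>t. indicator {0..} (x + t) * killed_mean i (x + t)) \<in> borel_measurable \<mu>" for i by measurable
    show "integrable \<mu> (\<lambda>t. indicator {0..} (x + t) * renewal (x + t))"
      by (rule integrable_kill[OF linear_growth_renewal]) simp
    show "AE t in \<mu>. (\<lambda>n. indicator {0..} (x + t) * killed_mean n (x + t)) \<longlonglongrightarrow> indicator {0..} (x + t) * renewal (x + t)"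
      by (intro AE_I2 tendsto_mult_left killed_mean_tendsto)
    show "AE t in \<mu>. norm (indicator {0..} (x + t) * killed_mean i (x + t)) \<le> indicator {0..} (x + t) * renewal (x + t)" for i
      using killed_mean_nonneg killed_mean_le_renewal by (intro AE_I2) (auto simp: indicator_def abs_mult)
  qed
  moreover have "(\<lambda>n. kill {0..} (killed_mean n) x) \<longlonglongrightarrow> renewal x"
    using LIMSEQ_Suc[OF killed_mean_tendsto[of x]] unfolding killed_mean_Suc .
  ultimately show ?thesis by (rule LIMSEQ_unique)
qed

text \<open>One step is enough: the mean of the positive part of a step is positive, since
  \<open>t\<^sup>2 \<le> b * max 0 t\<close> on \<open>{0..b}\<close>.\<close>

lemma renewal_0_pos: "renewal 0 > 0"
proof -
  obtain b where b: "b \<ge> 1" "(\<integral>t. t\<^sup>2 * indicator {0..b} t \<partial>\<mu>) > 0"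
    using ex_positive_part by blast
  have i: "integrable \<mu> (\<lambda>t. max 0 (0 + t))" by (rule integrable_linear_growth) simp
  have "(\<integral>t. t\<^sup>2 * indicator {0..b} t \<partial>\<mu>) \<le> (\<integral>t. b * max 0 (0 + t) \<partial>\<mu>)"
    using b i integrable_indicator_mult[OF integrable_square, of "{0..b}"]
    by (intro integral_mono) (auto simp: indicator_def power2_eq_square max_def intro!: mult_right_mono)
  also have "\<dots> = b * kill {0..} (max 0) 0"
    unfolding kill_def by (auto simp: indicator_def max_def intro!: Bochner_Integration.integral_cong)
  also have "\<dots> \<le> b * renewal 0"
    using b killed_mean_le_renewal[of 1 0] by (intro mult_left_mono) (auto simp: killed_mean_def)
  finally show ?thesis using b by (meson less_le_trans zero_less_mult_pos zero_less_one)
qed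

end

section \<open>The functions H and L\<close>

interpretation std_normal: real_distribution std_normal_distribution
  by (rule real_dist_normal_dist)

lemma std_normal_density_le: "std_normal_density x \<le> 1 / sqrt (2 * pi)"
  unfolding std_normal_density_def by (simp add: divide_right_mono)

text \<open>This follows from \<open>1 + u \<le> exp u\<close>; the weaker
  \<open>1 - y\<^sup>2\<close> in place of \<open>1 - y\<^sup>2 / 2\<close> keeps the later bounds
  on \<open>L\<close> simple.\<close>

lemma std_normal_density_ge:
  assumes "\<bar>x\<bar> \<le> y" shows "std_normal_density x \<ge> (1 - y\<^sup>2) / sqrt (2 * pi)"
proof -
  have "x\<^sup>2 \<le> y\<^sup>2" using assms by (simp add: abs_le_square_iff[symmetric])
  moreover have "0 \<le> x\<^sup>2" by simp
  ultimately have "1 - y\<^sup>2 \<le> 1 + (- x\<^sup>2 / 2)" by linarith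
  also have "\<dots> \<le> exp (- x\<^sup>2 / 2)" by (rule exp_ge_add_one_self)
  finally show ?thesis unfolding std_normal_density_def by (simp add: divide_right_mono)
qed

lemma emeasure_std_normal:
  "A \<in> sets borel \<Longrightarrow> emeasure std_normal_distribution A = (\<integral>\<^sup>+ x. ennreal (std_normal_density x) * indicator A x \<partial>lborel)"
  by (subst emeasure_density) auto

lemma std_normal_cdf_diff:
  assumes "a \<le> b"
  shows "ennreal (cdf std_normal_distribution b - cdf std_normal_distribution a)
      = (\<integral>\<^sup>+ x. ennreal (std_normal_density x) * indicator {a<..b} x \<partial>lborel)"
proof (cases "a = b")
  case False
  then have "a < b" using assms by simp
  then show ?thesis
    by (subst std_normal.cdf_diff_eq) (auto simp: std_normal.emeasure_eq_measure[symmetric] emeasure_std_normal)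
qed simp

lemma std_normal_cdf_diff_le:
  assumes "a \<le> b"
  shows "cdf std_normal_distribution b - cdf std_normal_distribution a \<le> (b - a) / sqrt (2 * pi)"
proof -
  have "ennreal (cdf std_normal_distribution b - cdf std_normal_distribution a)
     \<le> (\<integral>\<^sup>+ x. ennreal (1 / sqrt (2 * pi)) * indicator {a<..b} x \<partial>lborel)"
    unfolding std_normal_cdf_diff[OF assms]
    by (intro nn_integral_mono mult_right_mono ennreal_leI std_normal_density_le) auto
  also have "\<dots> = ennreal ((b - a) / sqrt (2 * pi))"
    using assms by (simp add: nn_integral_cmult ennreal_mult[symmetric])
  finally show ?thesis using assms by (subst (asm) ennreal_le_iff) auto
qed

lemma std_normal_cdf_diff_ge:
  assumes "0 \<le> y" "y \<le> 1"
  shows "cdf std_normal_distribution y - cdf std_normal_distribution 0 \<ge> y * (1 - y\<^sup>2) / sqrt (2 * pi)"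
proof -
  have y2: "y\<^sup>2 \<le> 1" using assms by (simp add: power_le_one)
  have "ennreal (y * (1 - y\<^sup>2) / sqrt (2 * pi)) = (\<integral>\<^sup>+ x. ennreal ((1 - y\<^sup>2) / sqrt (2 * pi)) * indicator {0<..y} x \<partial>lborel)"
  proof -
    have "y * (1 - y\<^sup>2) / sqrt (2 * pi) = (1 - y\<^sup>2) / sqrt (2 * pi) * y" by simp
    then show ?thesis using assms y2 by (subst nn_integral_cmult_indicator) (auto simp: ennreal_mult[symmetric])
  qed
  also have "\<dots> \<le> ennreal (cdf std_normal_distribution y - cdf std_normal_distribution 0)"
    unfolding std_normal_cdf_diff[OF assms(1)]
    by (intro nn_integral_mono) (auto simp: indicator_def intro!: ennreal_leI std_normal_density_ge)
  finally show ?thesis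
    using std_normal.cdf_nondecreasing[OF assms(1)] by (subst (asm) ennreal_le_iff) auto
qed

lemma std_normal_isCont_cdf: "isCont (cdf std_normal_distribution) x"
proof -
  have "emeasure std_normal_distribution {x} = 0"
    using AE_lborel_singleton[of x]
    by (subst emeasure_std_normal) (auto simp: nn_integral_0_iff_AE indicator_def elim!: eventually_mono)
  then show ?thesis by (simp add: std_normal.isCont_cdf std_normal.emeasure_eq_measure)
qed

text \<open>The density is even, and a single point has no mass.\<close>

lemma std_normal_cdf_minus:
  "cdf std_normal_distribution (- x) = 1 - cdf std_normal_distribution x"
proof -
  have 0: "measure std_normal_distribution {x} = 0"
    using std_normal_isCont_cdf[of x] by (simp add: std_normal.isCont_cdf)
  have "emeasure std_normal_distribution {..- x} = (\<integral>\<^sup>+ t. ennreal (std_normal_density t) * indicator {..- x} t \<partial>distr lborel borel uminus)"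
    by (simp add: emeasure_std_normal lborel_distr_uminus)
  also have "\<dots> = (\<integral>\<^sup>+ t. ennreal (std_normal_density t) * indicator {x..} t \<partial>lborel)"
    by (subst nn_integral_distr) (auto simp: std_normal_density_def indicator_def intro!: nn_integral_cong)
  also have "\<dots> = emeasure std_normal_distribution {x..}"
    by (simp add: emeasure_std_normal)
  finally have "cdf std_normal_distribution (- x) = measure std_normal_distribution {x..}"
    by (simp add: cdf_def measure_def)
  also have "{x..} = UNIV - ({..x} - {x})" by auto
  also have "measure std_normal_distribution \<dots> = 1 - measure std_normal_distribution ({..x} - {x})"
    using std_normal.prob_compl[of "{..x} - {x}"] by simp
  also have "measure std_normal_distribution ({..x} - {x}) = cdf std_normal_distribution x"
    by (subst std_normal.finite_measure_Diff) (auto simp: 0 cdf_def)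
  finally show ?thesis .
qed

lemma H_0 [simp]: "H 0 = 0"
  using std_normal_cdf_minus[of 0] by (simp add: H_def)

lemma H_minus: "H (- x) = - H x"
  unfolding H_def std_normal_cdf_minus by simp

lemma mono_H: "x \<le> y \<Longrightarrow> H x \<le> H y"
  unfolding H_def using std_normal.cdf_nondecreasing[of x y] by simp

lemma H_le_1: "H x \<le> 1"
  unfolding H_def using std_normal.cdf_bounded_prob[of x] by simp

text \<open>The slope of \<open>H\<close> is at most \<open>2 / sqrt (2 * pi)\<close>, which is at
  most 1 because \<open>pi \<ge> 2\<close>.\<close>

lemma H_lipschitz:
  assumes "x \<le> y" shows "H y - H x \<le> y - x"
proof -
  have "2 * 2 \<le> 2 * pi" using pi_ge_two by linarith
  then have "sqrt (2 * 2) \<le> sqrt (2 * pi)" by (rule real_sqrt_le_mono)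
  then have s: "2 \<le> sqrt (2 * pi)" by simp
  have "H y - H x \<le> (y - x) * (2 / sqrt (2 * pi))"
    using std_normal_cdf_diff_le[OF assms] unfolding H_def by (simp add: field_simps)
  also have "\<dots> \<le> (y - x) * 1" using assms s by (intro mult_left_mono) auto
  finally show ?thesis by simp
qed

lemma L_minus: "L (- x) = L x"
  unfolding L_def by (simp add: H_minus)

lemma L_0_pos: "L 0 > 0"
  unfolding L_def by simp

lemma H_eq: "H x = x * L x"
  unfolding L_def by simp

lemma std_normal_cdf_0: "cdf std_normal_distribution 0 = 1 / 2"
  using std_normal_cdf_minus[of 0] by simp

lemma H_eq_cdf_diff: "H y = 2 * (cdf std_normal_distribution y - cdf std_normal_distribution 0)"
  by (simp add: H_def std_normal_cdf_0)

lemma H_le: assumes "0 \<le> y" shows "H y \<le> L 0 * y"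
  using mult_left_mono[OF std_normal_cdf_diff_le[OF assms], of 2] unfolding H_eq_cdf_diff by (simp add: L_def)

lemma H_ge: assumes "0 \<le> y" "y \<le> 1" shows "L 0 * (1 - y\<^sup>2) * y \<le> H y"
  using mult_left_mono[OF std_normal_cdf_diff_ge[OF assms], of 2] unfolding H_eq_cdf_diff
  by (simp add: L_def mult_ac)

lemma H_pos: assumes "0 < y" shows "0 < H y"
proof -
  define z where "z = min y (1 / 2)"
  have z: "0 < z" "z \<le> 1 / 2" "z \<le> y" using assms by (auto simp: z_def)
  have "z\<^sup>2 < 1" using z by (simp add: abs_square_less_1)
  then have "0 < L 0 * (1 - z\<^sup>2) * z" using z L_0_pos by simp
  also have "\<dots> \<le> H z" using z by (intro H_ge) auto
  also have "\<dots> \<le> H y" by (rule mono_H[OF z(3)])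
  finally show ?thesis .
qed

text \<open>Evenness of \<open>L\<close> extends the bounds to negative arguments, which occur for
  starting points between a negative \<open>a\<close> and zero.\<close>

lemma L_le: "L y \<le> L 0" and L_ge: "\<bar>y\<bar> \<le> 1 \<Longrightarrow> L 0 * (1 - y\<^sup>2) \<le> L y"
proof -
  have *: "L y \<le> L 0 \<and> (y \<le> 1 \<longrightarrow> L 0 * (1 - y\<^sup>2) \<le> L y)" if "y > 0" for y
    using H_le[of y] H_ge[of y] that by (auto simp: H_eq mult.commute)
  have "L \<bar>y\<bar> = L y" using L_minus[of y] by (simp add: abs_if)
  then show "L y \<le> L 0" "\<bar>y\<bar> \<le> 1 \<Longrightarrow> L 0 * (1 - y\<^sup>2) \<le> L y"
    using *[of "\<bar>y\<bar>"] by (cases "y = 0"; simp)+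
qed

lemma H_tendsto_1: "(H \<longlongrightarrow> 1) at_top"
proof -
  have "((\<lambda>x. 2 * cdf std_normal_distribution x - 1) \<longlongrightarrow> 2 * 1 - 1) at_top"
    by (intro tendsto_intros std_normal.cdf_lim_at_top_prob)
  then show ?thesis by (simp add: H_def[abs_def])
qed

section \<open>The limit law of the minimum of the walk\<close>

context random_walk
begin

text \<open>This is P (x + S_n \<le> 0), written as an iterate without killing so that its one-step
  recursion can be compared with that of \<open>survival\<close>.\<close>

definition nonpos_prob :: "nat \<Rightarrow> real \<Rightarrow> real" where
  "nonpos_prob n = (kill UNIV ^^ n) (indicator {..0})"

lemma nonpos_prob_0: "nonpos_prob 0 = indicator {..0}"
  and nonpos_prob_Suc: "nonpos_prob (Suc n) = kill UNIV (nonpos_prob n)"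
  unfolding nonpos_prob_def by simp_all

lemma linear_growth_nonpos_prob: "linear_growth (nonpos_prob n)"
  unfolding nonpos_prob_def
  by (rule linear_growth_kill_pow) (auto intro!: linear_growth_bounded[of _ 1] simp: indicator_def)

lemma alive_UNIV: "alive UNIV n x \<omega> = 1"
  unfolding alive_def by simp

lemma nonpos_prob_eq: "nonpos_prob n x = prob {\<omega> \<in> space M. x + walk X n \<omega> \<le> 0}"
proof -
  have "linear_growth (indicator {..0})"
    using linear_growth_nonpos_prob[of 0] by (simp add: nonpos_prob_0)
  then have "nonpos_prob n x = (\<integral>\<omega>. alive UNIV n x \<omega> * indicator {..0} (x + walk X n \<omega>) \<partial>M)"
    unfolding nonpos_prob_def by (rule expectation_alive[symmetric]) simp
  also have "\<dots> = (\<integral>\<omega>. indicator {\<omega> \<in> space M. x + walk X n \<omega> \<le> 0} \<omega> \<partial>M)"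
    by (intro Bochner_Integration.integral_cong) (auto simp: alive_UNIV indicator_def)
  finally show ?thesis by (simp add: Int_absorb2 subset_eq)
qed

lemma nonpos_prob_le_1: "nonpos_prob n x \<le> 1" and nonpos_prob_nonneg: "0 \<le> nonpos_prob n x"
  unfolding nonpos_prob_eq by simp_all

lemma nonpos_prob_antimono: "x \<le> y \<Longrightarrow> nonpos_prob n y \<le> nonpos_prob n x"
  unfolding nonpos_prob_eq by (intro finite_measure_mono) auto

lemma nonpos_prob_eq_cdf: "nonpos_prob n x = cdf (distr M borel (walk X n)) (- x)"
  unfolding nonpos_prob_eq cdf_def
  by (subst measure_distr) (auto intro!: arg_cong[where f=prob])

lemma nonpos_prob_at_top: "(nonpos_prob n \<longlongrightarrow> 0) at_top"
proof -
  interpret D: real_distribution "distr M borel (walk X n)" by (rule real_distribution_distr) measurable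
  have "((\<lambda>x. cdf (distr M borel (walk X n)) (- x)) \<longlongrightarrow> 0) at_top"
    by (rule filterlim_compose[OF D.cdf_lim_at_bot filterlim_uminus_at_bot_at_top])
  then show ?thesis by (simp add: nonpos_prob_eq_cdf[abs_def])
qed

lemma nonpos_prob_at_bot: "(nonpos_prob n \<longlongrightarrow> 1) at_bot"
proof -
  interpret D: real_distribution "distr M borel (walk X n)" by (rule real_distribution_distr) measurable
  have "((\<lambda>x. cdf (distr M borel (walk X n)) (- x)) \<longlongrightarrow> 1) at_bot"
    by (rule filterlim_compose[OF D.cdf_lim_at_top_prob filterlim_uminus_at_top_at_bot])
  then show ?thesis by (simp add: nonpos_prob_eq_cdf[abs_def])
qed

text \<open>The next two lemmas replace the reflection principle: after leaving the half line the walk is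
  below its position at the exit time with probability close to one half.\<close>

lemma nonpos_prob_le_exit:
  assumes s: "s > 0" and q: "\<And>m. m \<le> N \<Longrightarrow> nonpos_prob m s \<le> q" and "n \<le> N" "x \<ge> 0"
  shows "nonpos_prob n (x + 2 * s) \<le> q * (1 - survival n x) + n * measure \<mu> {..< -s}"
  using assms(3,4)
proof (induction n arbitrary: x)
  case 0
  then show ?case using s by (simp add: nonpos_prob_0)
next
  case (Suc n)
  have q0: "0 \<le> q" using q[of 0] nonpos_prob_nonneg[of 0 s] by simp
  let ?\<tau> = "measure \<mu> {..< -s}"
  have "nonpos_prob (Suc n) (x + 2 * s) = (\<integral>t. nonpos_prob n (x + 2 * s + t) \<partial>\<mu>)"
    by (simp add: nonpos_prob_Suc kill_def)
  also have "\<dots> \<le> (\<integral>t. q - q * (indicator {0..} (x + t) * survival n (x + t)) + n * ?\<tau> + indicator {..< -s} t \<partial>\<mu>)"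
  proof (rule integral_mono)
    show "integrable \<mu> (\<lambda>t. nonpos_prob n (x + 2 * s + t))"
      by (rule integrable_linear_growth[OF linear_growth_nonpos_prob])
    show "integrable \<mu> (\<lambda>t. q - q * (indicator {0..} (x + t) * survival n (x + t)) + n * ?\<tau> + indicator {..< -s} t)"
      by (intro Bochner_Integration.integrable_add Bochner_Integration.integrable_diff integrable_mult_right
          integrable_kill linear_growth_survival \<mu>.integrable_const integrable_real_indicator) (auto simp: less_top[symmetric])
    fix t
    have n0: "0 \<le> n * ?\<tau>" by simp
    \<comment> \<open>The shift \<open>2 * s\<close> has two halves: an exit by a jump of size at
      most \<open>s\<close> leaves the shifted walk at height at least \<open>s\<close>, where
      \<open>q\<close> applies. A longer downward jump is charged its full probability, once per
      step.\<close>
    consider "0 \<le> x + t" | "x + t < 0" "t < -s" | "x + t < 0" "-s \<le> t" by linarith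
    then show "nonpos_prob n (x + 2 * s + t) \<le> q - q * (indicator {0..} (x + t) * survival n (x + t)) + n * ?\<tau> + indicator {..< -s} t"
    proof cases
      case 1
      have "nonpos_prob n (x + t + 2 * s) \<le> q * (1 - survival n (x + t)) + n * ?\<tau>"
        using Suc.IH[of "x + t"] Suc.prems 1 by simp
      also have "q * (1 - survival n (x + t)) = q - q * (1 * survival n (x + t))"
        by (simp add: algebra_simps)
      also have "x + t + 2 * s = x + 2 * s + t" by simp
      finally show ?thesis using 1 by (simp add: add_increasing2)
    next
      case 2
      then have "q - q * (indicator {0..} (x + t) * survival n (x + t)) + n * ?\<tau> + indicator {..< -s} t
          = q + n * ?\<tau> + 1" by simp
      then show ?thesis using nonpos_prob_le_1[of n "x + 2 * s + t"] q0 n0 by linarith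
    next
      case 3
      have "nonpos_prob n (x + 2 * s + t) \<le> nonpos_prob n s" using 3 Suc.prems by (intro nonpos_prob_antimono) simp
      also have "\<dots> \<le> q" using Suc.prems by (intro q) simp
      finally show ?thesis using 3 n0 by (simp add: add_increasing2)
    qed
  qed
  also have "\<dots> = q - q * survival (Suc n) x + n * ?\<tau> + ?\<tau>"
  proof -
    have i: "integrable \<mu> (\<lambda>t. indicator {0..} (x + t) * survival n (x + t))"
      by (rule integrable_kill[OF linear_growth_survival]) simp
    have j: "integrable \<mu> (indicator {..< -s} :: real \<Rightarrow> real)"
      by (intro integrable_real_indicator) (auto simp: less_top[symmetric])
    show ?thesis
      using i j \<mu>.prob_space by (simp add: survival_Suc kill_def)
  qed
  finally show ?case by (simp add: algebra_simps)
qed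

lemma nonpos_prob_ge_exit:
  assumes q0: "q \<ge> 0" and q: "\<And>m. m \<le> N \<Longrightarrow> q \<le> nonpos_prob m (- s)" and "n \<le> N"
  shows "q * (1 - survival n x) \<le> nonpos_prob n (x - s)"
  using assms(3)
proof (induction n arbitrary: x)
  case 0
  then show ?case by (simp add: nonpos_prob_0)
next
  case (Suc n)
  have i: "integrable \<mu> (\<lambda>t. indicator {0..} (x + t) * survival n (x + t))"
    by (rule integrable_kill[OF linear_growth_survival]) simp
  have "q * (1 - survival (Suc n) x) = (\<integral>t. q - q * (indicator {0..} (x + t) * survival n (x + t)) \<partial>\<mu>)"
    using i \<mu>.prob_space by (simp add: survival_Suc kill_def algebra_simps)
  also have "\<dots> \<le> (\<integral>t. nonpos_prob n (x - s + t) \<partial>\<mu>)"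
  proof (rule integral_mono)
    show "integrable \<mu> (\<lambda>t. nonpos_prob n (x - s + t))"
      by (rule integrable_linear_growth[OF linear_growth_nonpos_prob])
    show "integrable \<mu> (\<lambda>t. q - q * (indicator {0..} (x + t) * survival n (x + t)))"
      using i by (intro Bochner_Integration.integrable_diff integrable_mult_right \<mu>.integrable_const)
    fix t
    show "q - q * (indicator {0..} (x + t) * survival n (x + t)) \<le> nonpos_prob n (x - s + t)"
    proof (cases "0 \<le> x + t")
      case True
      have "q * (1 - survival n (x + t)) \<le> nonpos_prob n (x + t - s)"
        using Suc by simp
      then show ?thesis using True by (simp add: algebra_simps)
    next
      case False
      \<comment> \<open>In this direction an undershoot only helps, so no jump term arises.\<close>
      have "q \<le> nonpos_prob n (- s)" using Suc.prems by (intro q) simp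
      also have "\<dots> \<le> nonpos_prob n (x - s + t)" using False by (intro nonpos_prob_antimono) simp
      finally show ?thesis using False by simp
    qed
  qed
  also have "\<dots> = nonpos_prob (Suc n) (x - s)"
    by (simp add: nonpos_prob_Suc kill_def)
  finally show ?case .
qed

text \<open>The central limit theorem is applied to a sequence indexed from 0, whereas the steps are
  numbered from 1.\<close>

lemma indep_shift: "indep_vars (\<lambda>_. borel) (\<lambda>n. X (Suc n)) UNIV"
proof -
  have "indep_vars (\<lambda>j. PiM {Suc j} (\<lambda>_. borel)) (\<lambda>j \<omega>. restrict (\<lambda>i. X i \<omega>) {Suc j}) UNIV"
    by (rule indep_vars_restrict[OF indep]) (auto simp: disjoint_family_on_def)
  then have "indep_vars (\<lambda>_. borel) (\<lambda>j \<omega>. (\<lambda>q. q (Suc j)) (restrict (\<lambda>i. X i \<omega>) {Suc j})) UNIV"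
    by (rule indep_vars_compose2) (auto intro!: measurable_component_singleton)
  then show ?thesis by simp
qed

end

section \<open>Consequences of the central limit theorem\<close>

context centred_walk
begin

text \<open>The event is that \<open>S_n / (\<sigma> * sqrt n)\<close> is at most
  \<open>- y\<close>; the normal law has no atoms, so weak convergence gives convergence at every
  point.\<close>

lemma central_limit:
  "(\<lambda>n. nonpos_prob n (y * (\<sigma> * sqrt n))) \<longlonglongrightarrow> cdf std_normal_distribution (- y)"
proof -
  have XS[measurable]: "X (Suc n) \<in> borel_measurable M" for n by (rule X_measurable) simp
  have dX: "distr M borel (X (Suc n)) = \<mu>" for n unfolding \<mu>_def by (rule identical) simp
  have mean: "expectation (X (Suc n)) = 0" for n
    using \<mu>_mean unfolding dX[of n, symmetric] by (subst (asm) integral_distr) auto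
  have int: "integrable M (\<lambda>\<omega>. (X (Suc n) \<omega>)\<^sup>2)" for n
    using integrable_square unfolding dX[of n, symmetric] by (subst (asm) integrable_distr_eq) auto
  have var: "variance (X (Suc n)) = \<sigma>\<^sup>2" for n
    using \<mu>_second unfolding dX[of n, symmetric] mean by (subst (asm) integral_distr) auto
  have "weak_conv_m (\<lambda>n. distr M borel (\<lambda>\<omega>. (\<Sum>i<n. X (Suc i) \<omega>) / sqrt (n * \<sigma>\<^sup>2))) std_normal_distribution"
    by (rule central_limit_theorem_zero_mean[OF indep_shift mean \<sigma>_pos int var dX])
  then have lim: "(\<lambda>n. cdf (distr M borel (\<lambda>\<omega>. (\<Sum>i<n. X (Suc i) \<omega>) / sqrt (n * \<sigma>\<^sup>2))) (- y))
      \<longlonglongrightarrow> cdf std_normal_distribution (- y)"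
    unfolding weak_conv_m_def weak_conv_def using std_normal_isCont_cdf by blast
  have "cdf (distr M borel (\<lambda>\<omega>. (\<Sum>i<n. X (Suc i) \<omega>) / sqrt (n * \<sigma>\<^sup>2))) (- y) = nonpos_prob n (y * (\<sigma> * sqrt n))"
    if "n > 0" for n
  proof -
    have w: "(\<Sum>i<n. X (Suc i) \<omega>) = walk X n \<omega>" for \<omega>
      unfolding walk_def by (rule sum.reindex_bij_witness[of _ "\<lambda>i. i - 1" Suc]) auto
    have "\<sigma> * sqrt n > 0" using \<sigma>_pos that by simp
    then have "x / (\<sigma> * sqrt n) \<le> - y \<longleftrightarrow> y * (\<sigma> * sqrt n) + x \<le> 0" for x
      by (simp add: pos_divide_le_eq) argo
    moreover have "sqrt (n * \<sigma>\<^sup>2) = \<sigma> * sqrt n" using \<sigma>_pos by (simp add: real_sqrt_mult)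
    ultimately show ?thesis
      unfolding w nonpos_prob_eq cdf_def by (subst measure_distr) (auto intro!: arg_cong[where f=prob])
  qed
  then show ?thesis
    by (intro Lim_transform_eventually[OF lim]) (auto intro!: eventually_mono[OF eventually_gt_at_top[of 0]])
qed

lemma scale_at_top: "filterlim (\<lambda>n. \<sigma> * sqrt (real n)) at_top sequentially"
  by (intro filterlim_tendsto_pos_mult_at_top[OF tendsto_const] \<sigma>_pos
      filterlim_compose[OF sqrt_at_top] filterlim_real_sequentially)

text \<open>Uniformity in \<open>m \<le> N\<close> comes from two regimes: for
  \<open>m \<ge> m0\<close> the value at 0 is already close to one half and raising the start only
  lowers it; for the finitely many smaller \<open>m\<close> the height tends to infinity with
  \<open>N\<close> and the probability vanishes.\<close>

lemma nonpos_prob_half_upper: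
  assumes "r > 0" "e > 0"
  shows "\<forall>\<^sub>F N in sequentially. \<forall>m\<le>N. nonpos_prob m (r * (\<sigma> * sqrt N)) \<le> 1 / 2 + e"
proof -
  have "(\<lambda>n. nonpos_prob n 0) \<longlonglongrightarrow> 1 / 2"
    using central_limit[of 0] by (simp add: std_normal_cdf_0)
  then have "\<forall>\<^sub>F n in sequentially. nonpos_prob n 0 < 1 / 2 + e" using assms by (intro order_tendstoD(2)) auto
  then obtain m0 where m0: "\<And>m. m \<ge> m0 \<Longrightarrow> nonpos_prob m 0 < 1 / 2 + e"
    unfolding eventually_sequentially by blast
  have lim: "filterlim (\<lambda>N. r * (\<sigma> * sqrt (real N))) at_top sequentially"
    by (intro filterlim_tendsto_pos_mult_at_top[OF tendsto_const] assms scale_at_top)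
  have "\<forall>\<^sub>F N in sequentially. nonpos_prob m (r * (\<sigma> * sqrt N)) < 1 / 2 + e" for m
    using assms by (intro order_tendstoD(2)[OF filterlim_compose[OF nonpos_prob_at_top lim]]) auto
  then have "\<forall>\<^sub>F N in sequentially. \<forall>m\<in>{..<m0}. nonpos_prob m (r * (\<sigma> * sqrt N)) < 1 / 2 + e"
    by (intro eventually_ball_finite) auto
  then show ?thesis
  proof (rule eventually_mono, intro allI impI)
    fix N m :: nat assume *: "\<forall>m\<in>{..<m0}. nonpos_prob m (r * (\<sigma> * sqrt N)) < 1 / 2 + e"
    have "nonpos_prob m (r * (\<sigma> * sqrt N)) \<le> nonpos_prob m 0" using assms \<sigma>_pos by (intro nonpos_prob_antimono) auto
    then show "nonpos_prob m (r * (\<sigma> * sqrt N)) \<le> 1 / 2 + e"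
      using * m0[of m] by (cases "m < m0") (auto intro: less_imp_le)
  qed
qed

lemma nonpos_prob_half_lower:
  assumes "r > 0" "e > 0"
  shows "\<forall>\<^sub>F N in sequentially. \<forall>m\<le>N. 1 / 2 - e \<le> nonpos_prob m (- (r * (\<sigma> * sqrt N)))"
proof -
  have "(\<lambda>n. nonpos_prob n 0) \<longlonglongrightarrow> 1 / 2"
    using central_limit[of 0] by (simp add: std_normal_cdf_0)
  then have "\<forall>\<^sub>F n in sequentially. 1 / 2 - e < nonpos_prob n 0" using assms by (intro order_tendstoD(1)) auto
  then obtain m0 where m0: "\<And>m. m \<ge> m0 \<Longrightarrow> 1 / 2 - e < nonpos_prob m 0"
    unfolding eventually_sequentially by blast
  have lim: "filterlim (\<lambda>N. - (r * (\<sigma> * sqrt (real N)))) at_bot sequentially"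
    by (intro filterlim_compose[OF filterlim_uminus_at_bot_at_top] filterlim_tendsto_pos_mult_at_top[OF tendsto_const] assms scale_at_top)
  have "\<forall>\<^sub>F N in sequentially. 1 / 2 - e < nonpos_prob m (- (r * (\<sigma> * sqrt N)))" for m
    using assms by (intro order_tendstoD(1)[OF filterlim_compose[OF nonpos_prob_at_bot lim]]) auto
  then have "\<forall>\<^sub>F N in sequentially. \<forall>m\<in>{..<m0}. 1 / 2 - e < nonpos_prob m (- (r * (\<sigma> * sqrt N)))"
    by (intro eventually_ball_finite) auto
  then show ?thesis
  proof (rule eventually_mono, intro allI impI)
    fix N m :: nat assume *: "\<forall>m\<in>{..<m0}. 1 / 2 - e < nonpos_prob m (- (r * (\<sigma> * sqrt N)))"
    have "nonpos_prob m 0 \<le> nonpos_prob m (- (r * (\<sigma> * sqrt N)))" using assms \<sigma>_pos by (intro nonpos_prob_antimono) auto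
    then show "1 / 2 - e \<le> nonpos_prob m (- (r * (\<sigma> * sqrt N)))"
      using * m0[of m] by (cases "m < m0") (auto intro: less_imp_le)
  qed
qed

text \<open>With \<open>s = r * \<sigma> * sqrt n\<close> the tail probability is at most
  \<open>abs_moment * s powr - \<delta> / s\<^sup>2\<close>. The factor \<open>n / s\<^sup>2\<close>
  does not depend on \<open>n\<close>, so \<open>s powr - \<delta>\<close> drives the product to
  0.\<close>

lemma large_jump_tendsto:
  assumes "r > 0"
  shows "(\<lambda>n. n * measure \<mu> {..< - (r * (\<sigma> * sqrt n))}) \<longlonglongrightarrow> 0"
proof (rule tendsto_sandwich[of "\<lambda>_. 0" _ _ "\<lambda>n::nat. abs_moment / (r * \<sigma>)\<^sup>2 * (r * (\<sigma> * sqrt n)) powr (- \<delta>)"])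
  have lim: "filterlim (\<lambda>N. r * (\<sigma> * sqrt (real N))) at_top sequentially"
    by (intro filterlim_tendsto_pos_mult_at_top[OF tendsto_const] assms scale_at_top)
  have "(\<lambda>n. abs_moment / (r * \<sigma>)\<^sup>2 * (r * (\<sigma> * sqrt n)) powr (- \<delta>)) \<longlonglongrightarrow> abs_moment / (r * \<sigma>)\<^sup>2 * 0"
    using \<delta> by (intro tendsto_intros tendsto_neg_powr lim) auto
  then show "(\<lambda>n. abs_moment / (r * \<sigma>)\<^sup>2 * (r * (\<sigma> * sqrt n)) powr (- \<delta>)) \<longlonglongrightarrow> 0" by simp
  have "n * measure \<mu> {..< - (r * (\<sigma> * sqrt n))} \<le> abs_moment / (r * \<sigma>)\<^sup>2 * (r * (\<sigma> * sqrt n)) powr (- \<delta>)" if "n > 0" for n :: nat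
  proof -
    define s where "s = r * (\<sigma> * sqrt n)"
    have s: "s > 0" using assms \<sigma>_pos that by (simp add: s_def)
    have "s * measure \<mu> {..< - s} = (\<integral>t. s * indicator {..< - s} t \<partial>\<mu>)" by simp
    also have "\<dots> \<le> (\<integral>t. \<bar>t\<bar> * indicator {t. s \<le> \<bar>t\<bar>} t \<partial>\<mu>)"
    proof (rule integral_mono)
      show "integrable \<mu> (\<lambda>t. \<bar>t\<bar> * indicator {t. s \<le> \<bar>t\<bar>} t)"
        by (intro integrable_indicator_mult integrable_abs integrable_id) measurable
      show "integrable \<mu> (\<lambda>t. s * indicator {..< - s} t)"
        by (intro integrable_mult_right integrable_real_indicator) (auto simp: less_top[symmetric])
    qed (auto simp: indicator_def)
    also have "\<dots> \<le> abs_moment * s powr - (1 + \<delta>)" by (rule tail_mean_le[OF s])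
    finally have "measure \<mu> {..< - s} \<le> abs_moment * s powr - (1 + \<delta>) / s" using s by (simp add: field_simps)
    also have "s powr - (1 + \<delta>) = s powr - \<delta> * s powr - 1"
      unfolding powr_add[symmetric] by (rule arg_cong[where f = "(powr) s"]) simp
    also have "abs_moment * (s powr - \<delta> * s powr - 1) / s = abs_moment * s powr - \<delta> / s\<^sup>2"
      using s by (simp add: powr_minus_divide power2_eq_square)
    finally have "n * measure \<mu> {..< - s} \<le> n * (abs_moment * s powr - \<delta> / s\<^sup>2)" by (intro mult_left_mono) auto
    also have "s\<^sup>2 = (r * \<sigma>)\<^sup>2 * n" using that by (simp add: s_def power_mult_distrib)
    finally show ?thesis using that unfolding s_def by simp
  qed
  then show "\<forall>\<^sub>F n in sequentially. n * measure \<mu> {..< - (r * (\<sigma> * sqrt n))} \<le> abs_moment / (r * \<sigma>)\<^sup>2 * (r * (\<sigma> * sqrt n)) powr (- \<delta>)"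
    by (auto intro!: eventually_mono[OF eventually_gt_at_top[of 0]])
qed auto

text \<open>Both comparison inequalities are used at \<open>s = r * \<sigma> * sqrt n\<close>. As
  \<open>r\<close> tends to 0 their bounds for the probability of exit meet at
  \<open>2 * cdf std_normal_distribution (- y)\<close>, which equals \<open>1 - H y\<close>.\<close>

theorem survival_tendsto:
  assumes y: "y \<ge> 0"
  shows "(\<lambda>n. survival n (y * (\<sigma> * sqrt n))) \<longlonglongrightarrow> H y"
proof (rule order_tendstoI)
  let ?P = "cdf std_normal_distribution"
  have T: "2 * ?P (- y) = 1 - H y" unfolding H_def std_normal_cdf_minus by simp
  {
    fix a assume "a < H y"
    \<comment> \<open>The width \<open>r\<close> is fixed by continuity before \<open>n\<close>
      tends to infinity; \<open>r < 1 / 4\<close> keeps the denominator positive.\<close>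
    have "((\<lambda>r. ?P (- (y - r)) / (1 / 2 - r)) \<longlongrightarrow> ?P (- (y - 0)) / (1 / 2 - 0)) (at_right 0)"
      by (intro tendsto_divide isCont_tendsto_compose[OF std_normal_isCont_cdf] tendsto_intros) auto
    then have "\<forall>\<^sub>F r in at_right 0. ?P (- (y - r)) / (1 / 2 - r) < 1 - a"
      using T \<open>a < H y\<close> by (intro order_tendstoD(2)) auto
    moreover have "\<forall>\<^sub>F r in at_right 0. r \<in> {0<..<1 / 4 :: real}"
      by (rule eventually_at_right_real) simp
    ultimately have "\<forall>\<^sub>F r in at_right 0. ?P (- (y - r)) / (1 / 2 - r) < 1 - a \<and> r \<in> {0<..<1 / 4}"
      by (rule eventually_conj)
    then obtain r where r: "?P (- (y - r)) / (1 / 2 - r) < 1 - a" "0 < r" "r < 1 / 4"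
      using eventually_happens'[OF trivial_limit_at_right_real] by fastforce
    have "(\<lambda>n. nonpos_prob n ((y - r) * (\<sigma> * sqrt n)) / (1 / 2 - r)) \<longlonglongrightarrow> ?P (- (y - r)) / (1 / 2 - r)"
      using r by (intro tendsto_divide central_limit tendsto_const) auto
    then have "\<forall>\<^sub>F n in sequentially. nonpos_prob n ((y - r) * (\<sigma> * sqrt n)) / (1 / 2 - r) < 1 - a"
      using r(1) by (rule order_tendstoD(2))
    moreover have "\<forall>\<^sub>F n in sequentially. \<forall>m\<le>n. 1 / 2 - r \<le> nonpos_prob m (- (r * (\<sigma> * sqrt n)))"
      using r by (intro nonpos_prob_half_lower) auto
    ultimately show "\<forall>\<^sub>F n in sequentially. a < survival n (y * (\<sigma> * sqrt n))"
    proof eventually_elim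
      case (elim n)
      have "(1 / 2 - r) * (1 - survival n (y * (\<sigma> * sqrt n))) \<le> nonpos_prob n (y * (\<sigma> * sqrt n) - r * (\<sigma> * sqrt n))"
        by (rule nonpos_prob_ge_exit[where N = n]) (use elim(2) r in auto)
      also have "y * (\<sigma> * sqrt n) - r * (\<sigma> * sqrt n) = (y - r) * (\<sigma> * sqrt n)" by (simp add: algebra_simps)
      finally have "1 - survival n (y * (\<sigma> * sqrt n)) \<le> nonpos_prob n ((y - r) * (\<sigma> * sqrt n)) / (1 / 2 - r)"
        using r by (simp add: pos_le_divide_eq mult.commute)
      then show ?case using elim(1) by linarith
    qed
  }
  {
    fix a assume "H y < a"
    have "((\<lambda>r. ?P (- (y + 2 * r)) / (1 / 2 + r)) \<longlongrightarrow> ?P (- (y + 2 * 0)) / (1 / 2 + 0)) (at_right 0)"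
      by (intro tendsto_divide isCont_tendsto_compose[OF std_normal_isCont_cdf] tendsto_intros) auto
    then have "\<forall>\<^sub>F r in at_right 0. 1 - a < ?P (- (y + 2 * r)) / (1 / 2 + r)"
      using T \<open>H y < a\<close> by (intro order_tendstoD(1)) auto
    moreover have "\<forall>\<^sub>F r in at_right 0. r \<in> {0<..<1 / 4 :: real}"
      by (rule eventually_at_right_real) simp
    ultimately have "\<forall>\<^sub>F r in at_right 0. 1 - a < ?P (- (y + 2 * r)) / (1 / 2 + r) \<and> r \<in> {0<..<1 / 4}"
      by (rule eventually_conj)
    then obtain r where r: "1 - a < (?P (- (y + 2 * r)) - 0) / (1 / 2 + r)" "0 < r" "r < 1 / 4"
      using eventually_happens'[OF trivial_limit_at_right_real] by fastforce
    have "(\<lambda>n. (nonpos_prob n ((y + 2 * r) * (\<sigma> * sqrt n)) - n * measure \<mu> {..< - (r * (\<sigma> * sqrt n))}) / (1 / 2 + r))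
      \<longlonglongrightarrow> (?P (- (y + 2 * r)) - 0) / (1 / 2 + r)"
      using r by (intro tendsto_divide tendsto_diff central_limit large_jump_tendsto tendsto_const) auto
    then have "\<forall>\<^sub>F n in sequentially. 1 - a < (nonpos_prob n ((y + 2 * r) * (\<sigma> * sqrt n)) - n * measure \<mu> {..< - (r * (\<sigma> * sqrt n))}) / (1 / 2 + r)"
      using r(1) by (rule order_tendstoD(1))
    moreover have "\<forall>\<^sub>F n in sequentially. \<forall>m\<le>n. nonpos_prob m (r * (\<sigma> * sqrt n)) \<le> 1 / 2 + r"
      using r by (intro nonpos_prob_half_upper) auto
    ultimately show "\<forall>\<^sub>F n in sequentially. survival n (y * (\<sigma> * sqrt n)) < a"
      using eventually_gt_at_top[of 0]
    proof eventually_elim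
      case (elim n)
      have "nonpos_prob n (y * (\<sigma> * sqrt n) + 2 * (r * (\<sigma> * sqrt n)))
          \<le> (1 / 2 + r) * (1 - survival n (y * (\<sigma> * sqrt n))) + n * measure \<mu> {..< - (r * (\<sigma> * sqrt n))}"
        by (rule nonpos_prob_le_exit[where N = n]) (use elim r \<sigma>_pos y in auto)
      also have "y * (\<sigma> * sqrt n) + 2 * (r * (\<sigma> * sqrt n)) = (y + 2 * r) * (\<sigma> * sqrt n)" by (simp add: algebra_simps)
      finally have "(nonpos_prob n ((y + 2 * r) * (\<sigma> * sqrt n)) - n * measure \<mu> {..< - (r * (\<sigma> * sqrt n))}) / (1 / 2 + r)
          \<le> 1 - survival n (y * (\<sigma> * sqrt n))"
        using r by (simp add: pos_divide_le_eq mult.commute)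
      then show ?case using elim(1) by linarith
    qed
  }
qed

text \<open>Pointwise convergence of monotone functions to a bounded continuous limit is uniform; a
  finite grid suffices.\<close>

theorem survival_uniform:
  assumes e: "e > 0"
  shows "\<forall>\<^sub>F n in sequentially. \<forall>x\<ge>0. \<bar>survival n x - H (x / (\<sigma> * sqrt n))\<bar> \<le> e"
proof -
  \<comment> \<open>One half of \<open>e\<close> covers the error at a grid point, the other the
    increment of \<open>H\<close> over a mesh, at most \<open>d\<close> by the Lipschitz bound.
    Beyond the last grid point both quantities are close to 1.\<close>
  define d where "d = e / 2"
  have d: "d > 0" using e by (simp add: d_def)
  have "\<forall>\<^sub>F y in at_top. 1 - d < H y" by (rule order_tendstoD(1)[OF H_tendsto_1]) (use d in simp)
  then obtain Y where Y: "\<And>y. y \<ge> Y \<Longrightarrow> 1 - d < H y" unfolding eventually_at_top_linorder by blast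
  obtain J :: nat where J: "Y / d \<le> J" using real_arch_simple by blast
  then have YJ: "Y \<le> J * d" using d by (simp add: field_simps)
  have "\<forall>\<^sub>F n in sequentially. \<bar>survival n (j * d * (\<sigma> * sqrt n)) - H (j * d)\<bar> < d" for j :: nat
    using tendstoD[OF survival_tendsto[of "j * d"] d] d by (simp add: dist_real_def)
  then have "\<forall>\<^sub>F n in sequentially. \<forall>j\<in>{..J}. \<bar>survival n (real j * d * (\<sigma> * sqrt n)) - H (real j * d)\<bar> < d"
    by (intro eventually_ball_finite) auto
  then show ?thesis
    using eventually_gt_at_top[of 0]
  proof eventually_elim
    case (elim n)
    define z where "z = \<sigma> * sqrt n"
    have z: "z > 0" using \<sigma>_pos elim by (simp add: z_def)
    have grid: "\<bar>survival n (real j * d * z) - H (real j * d)\<bar> < d" if "j \<le> J" for j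
      using elim(1) that by (simp add: z_def)
    show ?case
    proof (intro allI impI)
      fix x :: real assume x: "x \<ge> 0"
      define y where "y = x / z"
      have xy: "x = y * z" using z by (simp add: y_def)
      have y: "y \<ge> 0" using x z by (simp add: y_def)
      have "\<bar>survival n x - H y\<bar> \<le> e"
      proof (cases "y < J * d")
        case True
        define j where "j = nat \<lfloor>y / d\<rfloor>"
        have j: "real j \<le> y / d" "y / d < real j + 1" using y d by (auto simp: j_def)
        then have jy: "real j * d \<le> y" "y \<le> real (Suc j) * d" using d by (auto simp: field_simps)
        have "real j * d < J * d" using jy(1) True by linarith
        then have "j < J" using d by simp
        then have g: "\<bar>survival n (real j * d * z) - H (real j * d)\<bar> < d"
          "\<bar>survival n (real (Suc j) * d * z) - H (real (Suc j) * d)\<bar> < d"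
          using grid[of j] grid[of "Suc j"] by auto
        have "survival n (real j * d * z) \<le> survival n x" "survival n x \<le> survival n (real (Suc j) * d * z)"
          unfolding xy using jy z by (auto intro!: monoD[OF mono_survival] mult_right_mono)
        moreover have "H y \<le> H (real (Suc j) * d)" "H (real j * d) \<le> H y" using jy by (auto intro: mono_H)
        moreover have "H (real (Suc j) * d) - H (real j * d) \<le> d"
          using H_lipschitz[of "real j * d" "real (Suc j) * d"] d by (simp add: algebra_simps)
        ultimately show ?thesis using g d_def by linarith
      next
        case False
        have "survival n (J * d * z) \<le> survival n x"
          unfolding xy using False z by (auto intro!: monoD[OF mono_survival] mult_right_mono)
        moreover have "1 - d < H (J * d)" "1 - d < H y" using YJ False by (auto intro!: Y)
        ultimately show ?thesis using grid[of J] survival_le_1[of n x] H_le_1[of y] d_def by linarith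
      qed
      then show "\<bar>survival n x - H (x / (\<sigma> * sqrt n))\<bar> \<le> e" by (simp add: y_def z_def)
    qed
  qed
qed

section \<open>Finiteness of the exit time and the identification of \<open>V\<close>\<close>

lemma survival_tendsto_0: "(\<lambda>n. survival n x) \<longlonglongrightarrow> 0"
proof (rule order_tendstoI)
  fix a :: real assume "a < 0"
  then show "\<forall>\<^sub>F n in sequentially. a < survival n x"
    by (intro always_eventually allI less_le_trans[OF _ survival_nonneg])
next
  fix a :: real assume a: "0 < a"
  \<comment> \<open>A fixed \<open>x\<close> eventually lies below
    \<open>y * \<sigma> * sqrt n\<close>, and this \<open>y\<close> makes the limit
    \<open>H y\<close> at most \<open>a / 2\<close>.\<close>
  define y where "y = a / (2 * L 0)"
  have y: "y > 0" using a L_0_pos by (simp add: y_def)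
  have "H y \<le> L 0 * y" using y by (intro H_le) simp
  also have "\<dots> < a" using a L_0_pos by (simp add: y_def)
  finally have "\<forall>\<^sub>F n in sequentially. survival n (y * (\<sigma> * sqrt n)) < a"
    using y by (intro order_tendstoD(2)[OF survival_tendsto]) auto
  moreover have "filterlim (\<lambda>n. y * (\<sigma> * sqrt (real n))) at_top sequentially"
    by (intro filterlim_tendsto_pos_mult_at_top[OF tendsto_const] y scale_at_top)
  then have "\<forall>\<^sub>F n in sequentially. x \<le> y * (\<sigma> * sqrt (real n))"
    by (simp add: filterlim_at_top)
  ultimately show "\<forall>\<^sub>F n in sequentially. survival n x < a"
    by eventually_elim (meson le_less_trans monoD mono_survival)
qed

text \<open>Optional stopping at min (n, tau_x) splits \<open>x\<close> into the mean over surviving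
  paths and the mean over paths that have left. The latter part is of one sign and monotone in
  \<open>n\<close>, so monotone convergence gives both the integrability of the exit position and
  its mean.\<close>

theorem V_eq_renewal: "V M X x = renewal x"
proof -
  define \<tau> where "\<tau> = exit_time X x"
  define Z where "Z n \<omega> = (if enat n < \<tau> \<omega> then 0 else - (x + exit_position X x \<omega>))" for n \<omega>
  define I where "I n \<omega> = (if enat n < \<tau> \<omega> then 0 else 1 :: real)" for n \<omega>
  define Z' where "Z' \<omega> = (if \<tau> \<omega> = \<infinity> then 0 else - (x + exit_position X x \<omega>))" for \<omega>
  define I' where "I' \<omega> = (if \<tau> \<omega> = \<infinity> then 0 else 1 :: real)" for \<omega>
  \<comment> \<open>\<open>S n\<close> is the position at time \<open>n\<close> of the walk frozen
    at its exit position; \<open>Z n\<close> is the depth below zero of the paths that have already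
    left.\<close>
  define S where "S n \<omega> = alive {0..} n x \<omega> * (x + walk X n \<omega>) - Z n \<omega>" for n \<omega>
  have al: "alive {0..} n x \<omega> = (if enat n < \<tau> \<omega> then 1 else 0)" for n \<omega>
    unfolding \<tau>_def by (rule alive_half_line)
  have exit_neg: "x + exit_position X x \<omega> < 0" "exit_position X x \<omega> = walk X k \<omega>" if "\<tau> \<omega> = enat k" for k \<omega>
  proof -
    have ne: "{k. 1 \<le> k \<and> x + walk X k \<omega> < 0} \<noteq> {}"
      using that unfolding \<tau>_def exit_time_def by (auto simp: top_enat_def Inf_enat_def split: if_splits)
    then have "exit_time X x \<omega> \<in> enat ` {k. 1 \<le> k \<and> x + walk X k \<omega> < 0}"
      unfolding exit_time_def by (intro wellorder_InfI[of "enat (SOME k. k \<in> {k. 1 \<le> k \<and> x + walk X k \<omega> < 0})"]) (auto intro: someI2_ex)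
    then have "x + walk X k \<omega> < 0" using that unfolding \<tau>_def by auto
    then show "x + exit_position X x \<omega> < 0" "exit_position X x \<omega> = walk X k \<omega>"
      using that unfolding \<tau>_def exit_position_def by auto
  qed
  have S_0: "S 0 \<omega> = x" for \<omega>
    using al[of 0 \<omega>] by (auto simp: S_def Z_def alive_0 walk_def split: if_splits)
  have S_Suc: "S (Suc n) \<omega> = S n \<omega> + (alive {0..} n x \<omega> * (x + walk X (Suc n) \<omega>) - alive {0..} n x \<omega> * (x + walk X n \<omega>))" for n \<omega>
  proof -
    consider "enat (Suc n) < \<tau> \<omega>" | "\<tau> \<omega> = enat (Suc n)" | "\<tau> \<omega> \<le> enat n"
      by (metis Suc_ile_eq linorder_not_le order_le_less)
    then show ?thesis
    proof cases
      case 1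
      then have "enat n < \<tau> \<omega>" by (meson enat_ord_simps(2) lessI less_trans)
      then show ?thesis using 1 by (simp add: S_def Z_def al)
    next
      case 2
      then show ?thesis using exit_neg(2)[OF 2] by (simp add: S_def Z_def al)
    next
      case 3
      then have "\<not> enat n < \<tau> \<omega>" "\<not> enat (Suc n) < \<tau> \<omega>"
        by (auto simp: not_less intro: order_trans)
      then show ?thesis by (simp add: S_def Z_def al)
    qed
  qed
  have intA: "integrable M (\<lambda>\<omega>. alive {0..} n x \<omega> * (x + walk X k \<omega>))" for n k
    by (intro integrable_alive_mult) (use integrable_walk in auto)
  have S: "integrable M (S n) \<and> expectation (S n) = x" for n
  proof (induction n)
    case 0
    then show ?case by (simp add: S_0 prob_space cong: Bochner_Integration.integrable_cong)
  next
    case (Suc n)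
    have "kill UNIV (\<lambda>y. y) = (\<lambda>y. y)"
      unfolding kill_def using integrable_id \<mu>_mean \<mu>.prob_space by simp
    then have "(\<integral>\<omega>. alive {0..} n x \<omega> * (x + walk X (Suc n) \<omega>) \<partial>M) = (\<integral>\<omega>. alive {0..} n x \<omega> * (x + walk X n \<omega>) \<partial>M)"
      using expectation_alive_step[of "\<lambda>y. y" "{0..}" n x] by simp
    then show ?case
      using Suc intA[of n n] intA[of n "Suc n"] unfolding S_Suc[abs_def] by simp
  qed
  have Z_eq: "Z n = (\<lambda>\<omega>. alive {0..} n x \<omega> * (x + walk X n \<omega>) - S n \<omega>)" for n
    by (simp add: S_def fun_eq_iff)
  have int_Z: "integrable M (Z n)" for n
    unfolding Z_eq using S intA by auto
  \<comment> \<open>Restricted to \<open>Suc n\<close> because \<open>killed_mean 0\<close> is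
    \<open>max 0\<close> and not the identity; after at least one step a surviving position is
    nonnegative, so both agree.\<close>
  have exp_Z: "expectation (Z (Suc n)) = killed_mean (Suc n) x - x" for n
  proof -
    have "expectation (Z (Suc n)) = (\<integral>\<omega>. alive {0..} (Suc n) x \<omega> * (x + walk X (Suc n) \<omega>) \<partial>M) - x"
      unfolding Z_eq using S[of "Suc n"] intA by simp
    also have "(\<lambda>\<omega>. alive {0..} (Suc n) x \<omega> * (x + walk X (Suc n) \<omega>)) = (\<lambda>\<omega>. alive {0..} (Suc n) x \<omega> * max 0 (x + walk X (Suc n) \<omega>))"
      by (auto simp: fun_eq_iff alive_Suc indicator_def)
    also have "(\<integral>\<omega>. alive {0..} (Suc n) x \<omega> * max 0 (x + walk X (Suc n) \<omega>) \<partial>M) = killed_mean (Suc n) x"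
      unfolding killed_mean_def by (rule expectation_alive) auto
    finally show ?thesis .
  qed
  have lim: "(\<lambda>n. f n) \<longlonglongrightarrow> (if \<tau> \<omega> = \<infinity> then 0 else c)"
    if f: "\<And>n. f n = (if enat n < \<tau> \<omega> then 0 else c)" for f and c :: real and \<omega>
  proof (cases "\<tau> \<omega>")
    case (enat k)
    have "\<forall>\<^sub>F n in sequentially. c = f n"
      using eventually_ge_at_top[of k] by eventually_elim (simp add: f enat)
    then show ?thesis using enat by (simp add: Lim_transform_eventually[OF tendsto_const])
  qed (simp add: f)
  have lim_Z: "(\<lambda>n. Z n \<omega>) \<longlonglongrightarrow> Z' \<omega>" for \<omega>
    unfolding Z'_def by (rule lim) (simp add: Z_def)
  have lim_I: "(\<lambda>n. I n \<omega>) \<longlonglongrightarrow> I' \<omega>" for \<omega>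
    unfolding I'_def by (rule lim) (simp add: I_def)
  have mono_Z: "mono (\<lambda>n. Z n \<omega>)" for \<omega>
  proof (rule incseq_SucI)
    fix n
    show "Z n \<omega> \<le> Z (Suc n) \<omega>"
    proof (cases "\<tau> \<omega>")
      case (enat k)
      then show ?thesis using exit_neg(1)[OF enat] by (auto simp: Z_def)
    qed (simp add: Z_def)
  qed
  have lim_exp: "(\<lambda>n. expectation (Z n)) \<longlonglongrightarrow> renewal x - x"
    by (subst filterlim_sequentially_Suc[symmetric], unfold exp_Z)
       (intro tendsto_diff tendsto_const LIMSEQ_Suc[OF killed_mean_tendsto])
  have Z'_meas: "Z' \<in> borel_measurable M"
    by (rule borel_measurable_LIMSEQ_real[OF lim_Z]) (use int_Z in auto)
  have Z'_int: "integrable M Z'"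
    by (rule integrable_monotone_convergence[OF int_Z _ _ lim_exp Z'_meas]) (auto intro: mono_Z lim_Z)
  have Z'_exp: "expectation Z' = renewal x - x"
    by (rule integral_monotone_convergence[OF int_Z _ _ lim_exp Z'_meas]) (auto intro: mono_Z lim_Z)
  have I_eq: "I n = (\<lambda>\<omega>. 1 - alive {0..} n x \<omega>)" for n
    by (simp add: I_def al fun_eq_iff)
  have I_meas: "I n \<in> borel_measurable M" for n unfolding I_eq by measurable
  have I'_meas: "I' \<in> borel_measurable M"
    by (rule borel_measurable_LIMSEQ_real[OF lim_I I_meas])
  have "(\<lambda>n. expectation (I n)) \<longlonglongrightarrow> expectation I'"
  proof (rule integral_dominated_convergence[where w = "\<lambda>_. 1"])
    show "AE \<omega> in M. norm (I n \<omega>) \<le> 1" for n by (simp add: I_def)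
  qed (auto intro: lim_I I_meas I'_meas)
  moreover have "expectation (I n) = 1 - survival n x" for n
    unfolding I_eq survival_def
    using integrable_alive_mult[of "\<lambda>_. 1" "{0..}" n x] expectation_alive[of "\<lambda>_. 1" "{0..}" n x] by (simp add: prob_space)
  ultimately have "(\<lambda>n. 1 - survival n x) \<longlonglongrightarrow> expectation I'" by simp
  moreover have "(\<lambda>n. 1 - survival n x) \<longlonglongrightarrow> 1 - 0"
    by (intro tendsto_diff tendsto_const survival_tendsto_0)
  ultimately have I'_exp: "expectation I' = 1" using LIMSEQ_unique by fastforce
  have I'_int: "integrable M I'"
    by (rule integrable_const_bound[of _ 1]) (auto simp: I'_def I'_meas)
  \<comment> \<open>On paths that never leave, both terms vanish, which matches the convention in
    \<open>exit_position\<close>; the mean of \<open>I'\<close> is 1 because the exit time is almost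
    surely finite.\<close>
  have "exit_position X x \<omega> = - Z' \<omega> - x * I' \<omega>" for \<omega>
    unfolding Z'_def I'_def \<tau>_def by (auto simp: exit_position_def)
  then have "V M X x = - (\<integral>\<omega>. - Z' \<omega> - x * I' \<omega> \<partial>M)"
    unfolding V_def by (rule arg_cong[OF Bochner_Integration.integral_cong[OF refl]])
  also have "\<dots> = renewal x"
    using Z'_int I'_int by (simp add: Z'_exp I'_exp)
  finally show ?thesis .
qed

section \<open>The exit from a strip\<close>

definition strip_survival :: "real \<Rightarrow> nat \<Rightarrow> real \<Rightarrow> real" where
  "strip_survival b k = (kill {0..b} ^^ k) (\<lambda>_. 1)"

text \<open>\<open>strip_time b j x\<close> is the expectation of the exit time from \<open>[0, b]\<close> truncated at \<open>j\<close>.\<close>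

definition strip_time :: "real \<Rightarrow> nat \<Rightarrow> real \<Rightarrow> real" where
  "strip_time b j = ((\<lambda>f x. 1 + kill {0..b} f x) ^^ j) (\<lambda>_. 0)"

lemma strip_survival_0 [simp]: "strip_survival b 0 x = 1"
  and strip_survival_Suc: "strip_survival b (Suc k) = kill {0..b} (strip_survival b k)"
  unfolding strip_survival_def by simp_all

lemma strip_time_0 [simp]: "strip_time b 0 x = 0"
  and strip_time_Suc: "strip_time b (Suc j) x = 1 + kill {0..b} (strip_time b j) x"
  unfolding strip_time_def by simp_all

lemma linear_growth_strip_survival: "linear_growth (strip_survival b k)"
  unfolding strip_survival_def by (rule linear_growth_kill_pow) auto

lemma linear_growth_strip_time: "linear_growth (strip_time b j)"
proof (induction j)
  case 0
  have "strip_time b 0 = (\<lambda>_. 0)" by (simp add: fun_eq_iff)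
  then show ?case by simp
next
  case (Suc j)
  then show ?case
    unfolding strip_time_Suc[abs_def] by (intro linear_growth_add linear_growth_kill) auto
qed

lemma strip_survival_nonneg: "0 \<le> strip_survival b k x"
  by (induction k arbitrary: x) (auto simp: strip_survival_Suc intro: kill_nonneg)

lemma strip_time_nonneg: "0 \<le> strip_time b j x"
  by (induction j arbitrary: x) (auto simp: strip_time_Suc intro!: add_nonneg_nonneg kill_nonneg)

lemma strip_survival_le_1: "strip_survival b k x \<le> 1"
proof (induction k arbitrary: x)
  case (Suc k)
  have "kill {0..b} (strip_survival b k) x \<le> (\<integral>t. 1 \<partial>\<mu>)"
    unfolding kill_def
    by (intro integral_mono integrable_kill linear_growth_strip_survival)
       (auto simp: indicator_def Suc)
  then show ?case using \<mu>.prob_space by (simp add: strip_survival_Suc)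
qed simp

text \<open>Markov's inequality for the exit time from the strip, truncated at
  \<open>k\<close>.\<close>

lemma strip_survival_le_strip_time: "k * strip_survival b k x \<le> strip_time b k x"
proof (induction k arbitrary: x)
  case (Suc k)
  have "k * strip_survival b (Suc k) x = kill {0..b} (\<lambda>y. k * strip_survival b k y) x"
    by (simp add: strip_survival_Suc kill_cmult)
  also have "\<dots> \<le> kill {0..b} (strip_time b k) x"
    by (intro kill_mono linear_growth_cmult linear_growth_strip_survival linear_growth_strip_time Suc.IH) simp
  finally show ?case
    using strip_survival_le_1[of b "Suc k" x] by (simp add: strip_time_Suc algebra_simps)
qed simp

text \<open>The square on \<open>{0..B}\<close>, continued by 0 on the left and by its tangent at
  \<open>B\<close> on the right. It stays convex but grows only linearly, so it belongs to the class
  of the operator and is dominated by a multiple of \<open>renewal\<close>.\<close>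

definition capped_square :: "real \<Rightarrow> real \<Rightarrow> real" where
  "capped_square B y = (if y \<le> 0 then 0 else if y \<le> B then y\<^sup>2 else 2 * B * y - B\<^sup>2)"

lemma capped_square_bounds:
  assumes "B \<ge> 0"
  shows "0 \<le> capped_square B y" "y \<ge> 0 \<Longrightarrow> capped_square B y \<le> 2 * B * y"
proof -
  have a: "0 \<le> 2 * B * y - B\<^sup>2" if "B < y"
  proof -
    have "B * B \<le> B * y" using assms that by (intro mult_left_mono) auto
    moreover have "0 \<le> B * y" using assms that by simp
    ultimately show ?thesis by (simp add: power2_eq_square)
  qed
  show "0 \<le> capped_square B y" using a by (auto simp: capped_square_def)
  have b: "y\<^sup>2 \<le> 2 * B * y" if "0 < y" "y \<le> B"
  proof -
    have "y * y \<le> B * y" using that by (intro mult_right_mono) auto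
    moreover have "0 \<le> B * y" using assms that by simp
    ultimately show ?thesis by (simp add: power2_eq_square)
  qed
  show "y \<ge> 0 \<Longrightarrow> capped_square B y \<le> 2 * B * y"
    using b assms by (auto simp: capped_square_def)
qed

lemma linear_growth_capped_square:
  assumes "B \<ge> 0" shows "linear_growth (capped_square B)"
proof (rule linear_growthI[of _ "2 * B"])
  show "capped_square B \<in> borel_measurable borel" unfolding capped_square_def[abs_def] by measurable
  fix y
  have "\<bar>capped_square B y\<bar> = capped_square B y" using capped_square_bounds[OF assms] by simp
  also have "\<dots> \<le> 2 * B * \<bar>y\<bar>"
  proof (cases "y \<ge> 0")
    case False
    have "0 \<le> 2 * B * \<bar>y\<bar>" using assms by (intro mult_nonneg_nonneg) auto
    then show ?thesis using False by (simp add: capped_square_def)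
  qed (use capped_square_bounds(2)[OF assms, of y] in simp)
  also have "\<dots> \<le> 2 * B * (1 + \<bar>y\<bar>)" using assms by (intro mult_left_mono) auto
  finally show "\<bar>capped_square B y\<bar> \<le> 2 * B * (1 + \<bar>y\<bar>)" .
qed

text \<open>With the cap at \<open>2 * b\<close>, a jump of size in \<open>{0..b}\<close> from the
  strip stays in the quadratic range and keeps its full gain \<open>t\<^sup>2\<close>. For all other
  jumps convexity gives the tangent bound.\<close>

lemma capped_square_tangent:
  assumes "0 \<le> x" "x \<le> b"
  shows "x\<^sup>2 + 2 * x * t + t\<^sup>2 * indicator {0..b} t \<le> capped_square (2 * b) (x + t)"
proof -
  consider "x + t < 0" | "0 \<le> x + t" "x + t \<le> 2 * b" | "2 * b < x + t" by linarith
  then show ?thesis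
  proof cases
    case 1
    have "x * (2 * t + x) \<le> 0" using 1 assms by (intro mult_nonneg_nonpos) auto
    then show ?thesis using 1 assms by (simp add: capped_square_def power2_eq_square algebra_simps)
  next
    case 2
    have "t\<^sup>2 * indicator {0..b} t \<le> t\<^sup>2" by (simp add: indicator_def)
    moreover have "capped_square (2 * b) (x + t) = (x + t)\<^sup>2" using 2 by (auto simp: capped_square_def)
    ultimately show ?thesis by (simp add: power2_sum)
  next
    case 3
    have "0 \<le> (2 * b - x) * (2 * (x + t) - x - 2 * b)"
      using 3 assms by (intro mult_nonneg_nonneg) auto
    then have "x\<^sup>2 + 2 * x * t \<le> 2 * (2 * b) * (x + t) - (2 * b)\<^sup>2"
      by (simp add: power2_eq_square algebra_simps)
    moreover have "indicator {0..b} t = (0 :: real)" using 3 assms by auto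
    ultimately show ?thesis using 3 assms by (simp add: capped_square_def)
  qed
qed

text \<open>The right-hand side is a Lyapunov function: \<open>renewal\<close> is harmonic, and
  \<open>capped_square\<close> gains at least the truncated second moment per step from the strip.
  So the difference drops by that amount in the mean.\<close>

lemma strip_time_quadratic:
  assumes b: "b \<ge> 0" and x: "0 \<le> x" "x \<le> b"
  shows "(\<integral>t. t\<^sup>2 * indicator {0..b} t \<partial>\<mu>) * strip_time b j x \<le> 4 * b * renewal x - capped_square (2 * b) x"
  using x
proof (induction j arbitrary: x)
  case 0
  have "capped_square (2 * b) x \<le> 4 * b * x" using capped_square_bounds(2)[of "2 * b" x] b 0 by simp
  also have "\<dots> \<le> 4 * b * renewal x" using pos_part_le_renewal[of x] b 0 by (intro mult_left_mono) auto
  finally show ?case by simp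
next
  case (Suc j)
  define s where "s = (\<integral>t. t\<^sup>2 * indicator {0..b} t \<partial>\<mu>)"
  have lin: "linear_growth (capped_square (2 * b))" using b by (intro linear_growth_capped_square) simp
  have lin': "linear_growth (\<lambda>y. 4 * b * renewal y - capped_square (2 * b) y)"
    by (intro linear_growth_diff linear_growth_cmult linear_growth_renewal lin)
  have int_s: "integrable \<mu> (\<lambda>t. t\<^sup>2 * indicator {0..b} t)"
    by (intro integrable_indicator_mult integrable_square) measurable
  have "s * strip_time b (Suc j) x = s + kill {0..b} (\<lambda>y. s * strip_time b j y) x"
    by (simp add: strip_time_Suc kill_cmult algebra_simps)
  also have "kill {0..b} (\<lambda>y. s * strip_time b j y) x \<le> kill {0..b} (\<lambda>y. 4 * b * renewal y - capped_square (2 * b) y) x"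
    by (intro kill_mono linear_growth_cmult linear_growth_strip_time lin') (use Suc.IH s_def in auto)
  \<comment> \<open>The Lyapunov function is nonnegative on the half line, so enlarging the strip to
    it only increases the integral and makes harmonicity applicable.\<close>
  also have "\<dots> \<le> kill {0..} (\<lambda>y. 4 * b * renewal y - capped_square (2 * b) y) x"
    unfolding kill_def
  proof (intro integral_mono integrable_kill lin')
    fix t
    have "0 \<le> 4 * b * renewal y - capped_square (2 * b) y" if "y \<ge> 0" for y
    proof -
      have "capped_square (2 * b) y \<le> 4 * b * y" using capped_square_bounds(2)[of "2 * b" y] b that by simp
      also have "\<dots> \<le> 4 * b * renewal y" using pos_part_le_renewal[of y] b by (intro mult_left_mono) auto
      finally show ?thesis by simp
    qed
    then show "indicator {0..b} (x + t) * (4 * b * renewal (x + t) - capped_square (2 * b) (x + t))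
        \<le> indicator {0..} (x + t) * (4 * b * renewal (x + t) - capped_square (2 * b) (x + t))"
      by (auto simp: indicator_def)
  qed auto
  also have "\<dots> = 4 * b * renewal x - kill {0..} (capped_square (2 * b)) x"
    by (subst kill_diff) (auto simp: kill_cmult kill_renewal intro: linear_growth_cmult linear_growth_renewal lin)
  finally have le: "s * strip_time b (Suc j) x \<le> s + (4 * b * renewal x - kill {0..} (capped_square (2 * b)) x)"
    by simp
  have "x\<^sup>2 + s = (\<integral>t. x\<^sup>2 + 2 * x * t + t\<^sup>2 * indicator {0..b} t \<partial>\<mu>)"
    using integrable_id int_s \<mu>_mean \<mu>.prob_space unfolding s_def by simp
  also have "\<dots> \<le> (\<integral>t. capped_square (2 * b) (x + t) \<partial>\<mu>)"
    by (intro integral_mono Bochner_Integration.integrable_add integrable_mult_right integrable_id int_s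
        \<mu>.integrable_const integrable_linear_growth lin capped_square_tangent Suc.prems)
  also have "\<dots> = kill {0..} (capped_square (2 * b)) x"
    unfolding kill_def by (intro Bochner_Integration.integral_cong) (auto simp: indicator_def capped_square_def)
  finally show ?case using le Suc.prems unfolding s_def by (auto simp: capped_square_def split: if_splits)
qed

text \<open>A negative start enters the strip after one step or not at all, which adds 1 to the
  bound. Positivity of \<open>renewal a\<close> absorbs it:
  \<open>1 \<le> b * renewal x / renewal a\<close>, whence the first summand of
  \<open>C\<close>.\<close>

lemma strip_time_bound:
  assumes a: "renewal a > 0"
  shows "\<exists>C>0. \<exists>b\<^sub>0\<ge>1. \<forall>b\<ge>b\<^sub>0. \<forall>j. \<forall>x. a \<le> x \<and> x \<le> b \<longrightarrow> strip_time b j x \<le> C * b * renewal x"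
proof -
  obtain b\<^sub>0 where b0: "b\<^sub>0 \<ge> 1" "(\<integral>t. t\<^sup>2 * indicator {0..b\<^sub>0} t \<partial>\<mu>) > 0"
    using ex_positive_part by blast
  define s where "s = (\<integral>t. t\<^sup>2 * indicator {0..b\<^sub>0} t \<partial>\<mu>)"
  have s: "s > 0" using b0 s_def by simp
  have pos: "strip_time b j x \<le> 4 / s * b * renewal x" if b: "b \<ge> b\<^sub>0" and x: "0 \<le> x" "x \<le> b" for b j x
  proof -
    have "s \<le> (\<integral>t. t\<^sup>2 * indicator {0..b} t \<partial>\<mu>)"
      unfolding s_def
      by (intro integral_mono integrable_indicator_mult integrable_square) (use b in \<open>auto simp: indicator_def\<close>)
    then have "s * strip_time b j x \<le> (\<integral>t. t\<^sup>2 * indicator {0..b} t \<partial>\<mu>) * strip_time b j x"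
      by (intro mult_right_mono strip_time_nonneg)
    also have "\<dots> \<le> 4 * b * renewal x"
      using strip_time_quadratic[of b x j] capped_square_bounds(1)[of "2 * b" x] b b0 x by simp
    finally show ?thesis using s by (simp add: field_simps)
  qed
  define C where "C = 1 / renewal a + 4 / s"
  have C: "C > 0" using a s by (simp add: C_def add_pos_pos)
  have "strip_time b j x \<le> C * b * renewal x" if b: "b \<ge> b\<^sub>0" and x: "a \<le> x" "x \<le> b" for b j x
  proof (cases "0 \<le> x")
    case True
    have "strip_time b j x \<le> 4 / s * b * renewal x" using pos b True x by simp
    also have "\<dots> \<le> C * b * renewal x"
      using b b0 a renewal_nonneg by (intro mult_right_mono) (auto simp: C_def)
    finally show ?thesis .
  next
    case False
    show ?thesis
    proof (cases j)
      case 0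
      then show ?thesis using C b b0 renewal_nonneg by simp
    next
      case (Suc i)
      have "kill {0..b} (strip_time b i) x \<le> kill {0..b} (\<lambda>y. 4 / s * b * renewal y) x"
        by (intro kill_mono linear_growth_strip_time linear_growth_cmult linear_growth_renewal pos b) auto
      also have "\<dots> \<le> kill {0..} (\<lambda>y. 4 / s * b * renewal y) x"
        unfolding kill_def
        using s b b0 renewal_nonneg
        by (intro integral_mono integrable_kill linear_growth_cmult linear_growth_renewal) (auto simp: indicator_def)
      also have "\<dots> = 4 / s * b * renewal x" by (simp only: kill_cmult kill_renewal)
      finally have 1: "strip_time b j x \<le> 1 + 4 / s * b * renewal x" by (simp add: Suc strip_time_Suc)
      have "renewal a \<le> renewal x" using x by (intro monoD[OF mono_renewal])
      also have "\<dots> \<le> b * renewal x" using mult_right_mono[of 1 b "renewal x"] b b0 renewal_nonneg by simp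
      finally have "1 \<le> 1 / renewal a * (b * renewal x)" using a by (simp add: field_simps)
      with 1 show ?thesis by (simp add: C_def algebra_simps)
    qed
  qed
  then show ?thesis using C b0(1) by blast
qed

text \<open>Either the first \<open>k\<close> steps stay in the strip, or the walk leaves it above
  at some \<open>y\<close> and still has to survive \<open>m\<close> steps, with probability at most
  \<open>\<kappa> * renewal y\<close>. Harmonicity adds these contributions up to at most
  \<open>\<kappa> * renewal x\<close>.\<close>

lemma survival_upper:
  assumes "\<kappa> \<ge> 0" "b \<ge> 0" and far: "\<And>y. y > b \<Longrightarrow> survival m y \<le> \<kappa> * y"
  shows "survival (k + m) x \<le> strip_survival b k x + \<kappa> * renewal x"
proof (induction k arbitrary: x)
  case 0
  have "0 \<le> \<kappa> * renewal x" using assms renewal_nonneg by simp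
  then show ?case using survival_le_1[of m x] by simp
next
  case (Suc k)
  have i: "integrable \<mu> (\<lambda>t. indicator {0..b} (x + t) * strip_survival b k (x + t))"
    "integrable \<mu> (\<lambda>t. indicator {0..} (x + t) * renewal (x + t))"
    by (auto intro!: integrable_kill linear_growth_strip_survival linear_growth_renewal)
  have "survival (Suc k + m) x = (\<integral>t. indicator {0..} (x + t) * survival (k + m) (x + t) \<partial>\<mu>)"
    by (simp add: survival_Suc kill_def)
  also have "\<dots> \<le> (\<integral>t. indicator {0..b} (x + t) * strip_survival b k (x + t) + \<kappa> * (indicator {0..} (x + t) * renewal (x + t)) \<partial>\<mu>)"
  proof (intro integral_mono Bochner_Integration.integrable_add integrable_mult_right i)
    show "integrable \<mu> (\<lambda>t. indicator {0..} (x + t) * survival (k + m) (x + t))"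
      by (rule integrable_kill[OF linear_growth_survival]) simp
    fix t
    define y where "y = x + t"
    consider "y < 0" | "0 \<le> y" "y \<le> b" | "b < y" by linarith
    then show "indicator {0..} (x + t) * survival (k + m) (x + t)
      \<le> indicator {0..b} (x + t) * strip_survival b k (x + t) + \<kappa> * (indicator {0..} (x + t) * renewal (x + t))"
      unfolding y_def[symmetric]
    proof cases
      case 2
      then show "indicator {0..} y * survival (k + m) y
        \<le> indicator {0..b} y * strip_survival b k y + \<kappa> * (indicator {0..} y * renewal y)" using Suc.IH[of y] by simp
    next
      case 3
      have "survival (k + m) y \<le> survival m y" by (rule antimono_survival) simp
      also have "\<dots> \<le> \<kappa> * y" by (rule far[OF 3])
      also have "\<dots> \<le> \<kappa> * renewal y" using pos_part_le_renewal[of y] assms by (intro mult_left_mono) auto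
      finally show "indicator {0..} y * survival (k + m) y
        \<le> indicator {0..b} y * strip_survival b k y + \<kappa> * (indicator {0..} y * renewal y)" using 3 assms by simp
    qed simp
  qed
  also have "\<dots> = strip_survival b (Suc k) x + \<kappa> * kill {0..} renewal x"
    using i by (simp add: strip_survival_Suc kill_def)
  finally show ?case by (simp add: kill_renewal)
qed

text \<open>Two parts of the harmonic mass of \<open>renewal x\<close> are given up: paths still in
  the strip after \<open>j\<close> steps, of value at most \<open>renewal b\<close> each, and jumps
  beyond \<open>2 * b\<close>, costing at most \<open>\<rho>\<close> per step started in the
  strip.\<close>

lemma survival_lower:
  assumes \<kappa>: "\<kappa> \<ge> 0" and b: "b \<ge> 0" and near: "\<And>y. b < y \<Longrightarrow> y \<le> 2 * b \<Longrightarrow> \<kappa> * renewal y \<le> survival n y"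
    and \<rho>: "\<rho> \<ge> 0" "\<And>x. x \<le> b \<Longrightarrow> kill {2 * b<..} renewal x \<le> \<rho>"
    and "j \<le> n" "x \<le> b"
  shows "\<kappa> * (renewal x - renewal b * strip_survival b j x - \<rho> * strip_time b j x) \<le> survival j x"
  using assms(6,7)
proof (induction j arbitrary: x)
  case 0
  have "renewal x \<le> renewal b" using 0 by (intro monoD[OF mono_renewal])
  then have "\<kappa> * (renewal x - renewal b) \<le> 0" using \<kappa> by (intro mult_nonneg_nonpos) auto
  then show ?case by simp
next
  case (Suc j)
  have i: "integrable \<mu> (\<lambda>t. indicator {0..b} (x + t) * strip_survival b j (x + t))"
    "integrable \<mu> (\<lambda>t. indicator {0..b} (x + t) * strip_time b j (x + t))"
    "integrable \<mu> (\<lambda>t. indicator {0..} (x + t) * renewal (x + t))"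
    "integrable \<mu> (\<lambda>t. indicator {2 * b<..} (x + t) * renewal (x + t))"
    by (auto intro!: integrable_kill linear_growth_strip_survival linear_growth_strip_time linear_growth_renewal)
  \<comment> \<open>The summand 1 in the recursion of \<open>strip_time\<close> pays for the
    overshoot of the present step.\<close>
  have "\<kappa> * (renewal x - renewal b * strip_survival b (Suc j) x - \<rho> * strip_time b (Suc j) x)
      \<le> \<kappa> * (kill {0..} renewal x - renewal b * kill {0..b} (strip_survival b j) x
          - \<rho> * kill {0..b} (strip_time b j) x - kill {2 * b<..} renewal x)"
    using \<rho>(2)[OF Suc.prems(2)] \<kappa> by (intro mult_left_mono) (auto simp: kill_renewal strip_survival_Suc strip_time_Suc algebra_simps)
  also have "\<dots> = (\<integral>t. \<kappa> * (indicator {0..} (x + t) * renewal (x + t)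
      - renewal b * (indicator {0..b} (x + t) * strip_survival b j (x + t))
      - \<rho> * (indicator {0..b} (x + t) * strip_time b j (x + t))
      - indicator {2 * b<..} (x + t) * renewal (x + t)) \<partial>\<mu>)"
    using i by (simp add: kill_def)
  also have "\<dots> \<le> (\<integral>t. indicator {0..} (x + t) * survival j (x + t) \<partial>\<mu>)"
  proof (intro integral_mono integrable_mult_right Bochner_Integration.integrable_diff i)
    show "integrable \<mu> (\<lambda>t. indicator {0..} (x + t) * survival j (x + t))"
      by (rule integrable_kill[OF linear_growth_survival]) simp
    fix t
    define y where "y = x + t"
    have "\<kappa> * (indicator {0..} y * renewal y
      - renewal b * (indicator {0..b} y * strip_survival b j y)
      - \<rho> * (indicator {0..b} y * strip_time b j y)
      - indicator {2 * b<..} y * renewal y) \<le> indicator {0..} y * survival j y"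
    proof -
      consider "y < 0" | "0 \<le> y" "y \<le> b" | "b < y" "y \<le> 2 * b" | "2 * b < y" by linarith
      then show ?thesis
      proof cases
        case 1
        then show ?thesis using b by simp
      next
        case 2
        then show ?thesis using b Suc.IH[of y] Suc.prems by simp
      next
        case 3
        have "\<kappa> * renewal y \<le> survival n y" by (rule near[OF 3])
        also have "\<dots> \<le> survival j y" using Suc.prems by (intro antimono_survival) simp
        finally show ?thesis using b 3 by simp
      next
        case 4
        then show ?thesis using b survival_nonneg by simp
      qed
    qed
    then show "\<kappa> * (indicator {0..} (x + t) * renewal (x + t)
      - renewal b * (indicator {0..b} (x + t) * strip_survival b j (x + t))
      - \<rho> * (indicator {0..b} (x + t) * strip_time b j (x + t))
      - indicator {2 * b<..} (x + t) * renewal (x + t)) \<le> indicator {0..} (x + t) * survival j (x + t)"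
      unfolding y_def .
  qed
  also have "\<dots> = survival (Suc j) x" by (simp add: survival_Suc kill_def)
  finally show ?case .
qed

text \<open>Such a jump satisfies \<open>b < t\<close>, so the new position is at most
  \<open>2 * t\<close> and \<open>renewal\<close> there is at most a multiple of \<open>t\<close>;
  the tail mean finishes.\<close>

lemma overshoot_bound:
  "\<exists>c>0. \<forall>b\<ge>1. \<forall>x\<le>b. kill {2 * b<..} renewal x \<le> c * b powr - (1 + \<delta>)"
proof -
  obtain c where c: "c > 0" "\<And>y. y \<ge> 1 \<Longrightarrow> renewal y \<le> c * y" using renewal_le_linear by blast
  have "kill {2 * b<..} renewal x \<le> (2 * c * abs_moment + 1) * b powr - (1 + \<delta>)" if b: "b \<ge> 1" "x \<le> b" for b x
  proof -
    have "kill {2 * b<..} renewal x \<le> (\<integral>t. 2 * c * (\<bar>t\<bar> * indicator {t. b \<le> \<bar>t\<bar>} t) \<partial>\<mu>)"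
      unfolding kill_def
    proof (intro integral_mono integrable_kill linear_growth_renewal integrable_mult_right)
      show "integrable \<mu> (\<lambda>t. \<bar>t\<bar> * indicator {t. b \<le> \<bar>t\<bar>} t)"
        by (intro integrable_indicator_mult integrable_abs integrable_id) measurable
      fix t
      show "indicator {2 * b<..} (x + t) * renewal (x + t) \<le> 2 * c * (\<bar>t\<bar> * indicator {t. b \<le> \<bar>t\<bar>} t)"
      proof (cases "2 * b < x + t")
        case True
        then have t: "b < t" using b by linarith
        have "renewal (x + t) \<le> renewal (2 * t)" using t b by (intro monoD[OF mono_renewal]) auto
        also have "\<dots> \<le> c * (2 * t)" using t b by (intro c) auto
        finally show ?thesis using True t b by simp
      next
        case False
        then show ?thesis using c by simp
      qed
    qed auto
    also have "\<dots> \<le> 2 * c * (abs_moment * b powr - (1 + \<delta>))"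
      using tail_mean_le[of b] b c by simp
    also have "\<dots> \<le> (2 * c * abs_moment + 1) * b powr - (1 + \<delta>)" by (simp add: algebra_simps)
    finally show ?thesis .
  qed
  then show ?thesis using c abs_moment_nonneg by (intro exI[of _ "2 * c * abs_moment + 1"]) (auto intro!: add_nonneg_pos)
qed

section \<open>The uniform equivalence\<close>

text \<open>About \<open>\<eta> * n\<close> steps are reserved for leaving the strip and the limit
  law is applied to the rest. The error \<open>e\<close> splits into three thirds: the shortened
  time, the error \<open>d\<close> of the limit law, and the paths that stay in the strip too
  long.\<close>

lemma survival_bulk_upper:
  assumes a: "renewal a > 0" and e: "e > 0"
  shows "\<exists>\<epsilon>\<^sub>0>0. \<forall>\<epsilon>. 0 < \<epsilon> \<and> \<epsilon> \<le> \<epsilon>\<^sub>0 \<longrightarrow> (\<forall>\<^sub>F n in sequentially. \<forall>x. a \<le> x \<and> x \<le> \<epsilon> * (\<sigma> * sqrt n) \<longrightarrow>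
      \<sigma> * sqrt n * survival n x \<le> (L 0 + e) * renewal x)"
proof -
  obtain C b\<^sub>0 where C: "C > 0" and b0: "b\<^sub>0 \<ge> 1"
    and time: "\<And>b j x. b \<ge> b\<^sub>0 \<Longrightarrow> a \<le> x \<Longrightarrow> x \<le> b \<Longrightarrow> strip_time b j x \<le> C * b * renewal x"
    using strip_time_bound[OF a] by blast
  have "((\<lambda>\<eta>. L 0 / sqrt (1 - \<eta>)) \<longlongrightarrow> L 0 / sqrt (1 - 0)) (at_right 0)"
    by (intro tendsto_intros) auto
  then have "\<forall>\<^sub>F \<eta> in at_right 0. L 0 / sqrt (1 - \<eta>) < L 0 + e / 3"
    using e by (intro order_tendstoD(2)) auto
  moreover have "\<forall>\<^sub>F \<eta> in at_right 0. \<eta> \<in> {0<..<1 / 2 :: real}"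
    by (rule eventually_at_right_real) simp
  ultimately have "\<forall>\<^sub>F \<eta> in at_right 0. L 0 / sqrt (1 - \<eta>) < L 0 + e / 3 \<and> \<eta> \<in> {0<..<1 / 2}"
    by (rule eventually_conj)
  then obtain \<eta> where \<eta>: "L 0 / sqrt (1 - \<eta>) < L 0 + e / 3" "0 < \<eta>" "\<eta> < 1 / 2"
    using eventually_happens'[OF trivial_limit_at_right_real] by fastforce
  \<comment> \<open>Staying in the strip for at least \<open>\<eta> * n / 2\<close> steps
    contributes at most \<open>2 * C * \<epsilon> * \<sigma>\<^sup>2 / \<eta> * renewal x\<close>
    after multiplication by \<open>z\<close>; this makes the factor at most
    \<open>e / 3\<close>.\<close>
  define \<epsilon>\<^sub>0 where "\<epsilon>\<^sub>0 = e * \<eta> / (6 * C * \<sigma>\<^sup>2)"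
  have \<epsilon>0: "\<epsilon>\<^sub>0 > 0" using e \<eta> C \<sigma>_pos by (simp add: \<epsilon>\<^sub>0_def)
  have main: "\<forall>\<^sub>F n in sequentially. \<forall>x. a \<le> x \<and> x \<le> \<epsilon> * (\<sigma> * sqrt n) \<longrightarrow>
      \<sigma> * sqrt n * survival n x \<le> (L 0 + e) * renewal x" if \<epsilon>: "0 < \<epsilon>" "\<epsilon> \<le> \<epsilon>\<^sub>0" for \<epsilon>
  proof -
    \<comment> \<open>An additive error of this size becomes relative beyond the strip:
      \<open>y > \<epsilon> * z\<close> gives \<open>d \<le> e / 3 * (y / z)\<close>.\<close>
    define d where "d = \<epsilon> * e / 3"
    have d: "d > 0" using \<epsilon> e by (simp add: d_def)
    obtain N where N: "\<And>m x. m \<ge> N \<Longrightarrow> x \<ge> 0 \<Longrightarrow> \<bar>survival m x - H (x / (\<sigma> * sqrt m))\<bar> \<le> d"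
      using survival_uniform[OF d] unfolding eventually_sequentially by blast
    have "filterlim (\<lambda>n. \<epsilon> * (\<sigma> * sqrt (real n))) at_top sequentially"
      by (intro filterlim_tendsto_pos_mult_at_top[OF tendsto_const] \<epsilon> scale_at_top)
    then have "\<forall>\<^sub>F n in sequentially. b\<^sub>0 \<le> \<epsilon> * (\<sigma> * sqrt (real n))"
      by (simp add: filterlim_at_top)
    \<comment> \<open>The summand \<open>2 / \<eta>\<close> makes the rounded-down \<open>k\<close>
      at least \<open>\<eta> * n / 2\<close>; \<open>2 * real N\<close> keeps the remaining time
      above \<open>N\<close>.\<close>
    moreover have "\<forall>\<^sub>F n in sequentially. 2 * real N + 2 / \<eta> + 1 \<le> real n"
      using filterlim_real_sequentially by (simp add: filterlim_at_top)
    ultimately show ?thesis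
    proof eventually_elim
      case (elim n)
      define z where "z = \<sigma> * sqrt n"
      have \<eta>2: "2 / \<eta> > 0" using \<eta> by simp
      have n0: "real n > 0" using elim(2) \<eta>2 by linarith
      have z: "z > 0" using \<sigma>_pos n0 by (simp add: z_def)
      have z2: "z * z = \<sigma>\<^sup>2 * n" by (simp add: z_def power2_eq_square)
      define b where "b = \<epsilon> * z"
      have b: "b \<ge> b\<^sub>0" "b > 0" using elim(1) \<epsilon> z by (auto simp: b_def z_def)
      define k where "k = nat \<lfloor>\<eta> * n\<rfloor>"
      have "\<eta> * n \<ge> 0" using \<eta> by simp
      then have k: "real k \<le> \<eta> * n" "\<eta> * n - 1 < real k" unfolding k_def by linarith+
      have "2 / \<eta> \<le> n" using elim(2) by linarith
      then have "2 \<le> \<eta> * n" using \<eta> by (simp add: field_simps)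
      then have k2: "real k \<ge> \<eta> * n / 2" "real k > 0" using k(2) by linarith+
      have "\<eta> * n \<le> 1 / 2 * n" using \<eta> by (intro mult_right_mono) auto
      then have kn: "real k \<le> n / 2" using k(1) by linarith
      define m where "m = n - k"
      have km: "k + m = n" using kn by (simp add: m_def)
      then have mk: "real m = n - real k" by linarith
      have m: "real m \<ge> (1 - \<eta>) * n" using k(1) unfolding mk by (simp add: algebra_simps)
      have "real m \<ge> n / 2" using kn mk by linarith
      then have "real m \<ge> real N" using elim(2) \<eta>2 by linarith
      then have mN: "m \<ge> N" by simp
      have zm: "\<sigma> * sqrt m \<ge> sqrt (1 - \<eta>) * z"
      proof -
        have "sqrt (1 - \<eta>) * sqrt n \<le> sqrt m" using m by (simp add: real_sqrt_mult[symmetric])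
        then show ?thesis using \<sigma>_pos by (simp add: z_def mult.left_commute)
      qed
      have s\<eta>: "sqrt (1 - \<eta>) > 0" using \<eta> by simp
      then have zm0: "\<sigma> * sqrt m > 0" using zm mult_pos_pos[OF s\<eta> z] by linarith
      have far: "survival m y \<le> (L 0 + 2 * e / 3) / z * y" if y: "y > b" for y
      proof -
        have y0: "y > 0" using y b by linarith
        have "survival m y \<le> H (y / (\<sigma> * sqrt m)) + d" using N[OF mN, of y] y0 by linarith
        also have "H (y / (\<sigma> * sqrt m)) \<le> H (y / (sqrt (1 - \<eta>) * z))"
          using zm zm0 s\<eta> z y0 by (intro mono_H divide_left_mono mult_pos_pos[OF zm0]) auto
        also have "\<dots> \<le> L 0 * (y / (sqrt (1 - \<eta>) * z))" using y0 z s\<eta> by (intro H_le) auto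
        also have "\<dots> = L 0 / sqrt (1 - \<eta>) * (y / z)" by simp
        also have "\<dots> \<le> (L 0 + e / 3) * (y / z)" using \<eta>(1) y0 z by (intro mult_right_mono) auto
        also have "d \<le> e / 3 * (y / z)" using y z e by (simp add: d_def b_def field_simps)
        finally show ?thesis by (simp add: algebra_simps add_divide_distrib)
      qed
      show ?case
      proof (intro allI impI)
        fix x assume x: "a \<le> x \<and> x \<le> \<epsilon> * (\<sigma> * sqrt n)"
        have "survival n x \<le> strip_survival b k x + (L 0 + 2 * e / 3) / z * renewal x"
          using survival_upper[of "(L 0 + 2 * e / 3) / z" b m k x] far b z e L_0_pos unfolding km by simp
        moreover have "z * strip_survival b k x \<le> e / 3 * renewal x"
        proof -
          have "k * strip_survival b k x \<le> C * b * renewal x"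
            using strip_survival_le_strip_time[of k b x] time[of b x k] b x by (simp add: b_def z_def)
          then have "\<eta> * n / 2 * strip_survival b k x \<le> C * b * renewal x"
            using mult_right_mono[OF k2(1) strip_survival_nonneg[of b k x]] by linarith
          then have "z * (\<eta> * n / 2 * strip_survival b k x) \<le> z * (C * b * renewal x)"
            using z by (intro mult_left_mono) auto
          also have "\<dots> = C * \<epsilon> * (z * z) * renewal x" by (simp add: b_def)
          also have "\<dots> = (C * \<epsilon> * \<sigma>\<^sup>2) * (n * renewal x)" unfolding z2 by simp
          also have "\<dots> \<le> (C * \<epsilon>\<^sub>0 * \<sigma>\<^sup>2) * (n * renewal x)"
            using \<epsilon> C renewal_nonneg by (intro mult_right_mono mult_left_mono mult_nonneg_nonneg) auto
          also have "C * \<epsilon>\<^sub>0 * \<sigma>\<^sup>2 = e * \<eta> / 6" using C \<sigma>_pos by (simp add: \<epsilon>\<^sub>0_def)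
          finally have "(n * \<eta>) * (z * strip_survival b k x) \<le> (n * \<eta>) * (e / 3 * renewal x)"
            by (simp add: mult_ac)
          then show ?thesis using n0 \<eta> by (subst (asm) mult_le_cancel_left_pos) auto
        qed
        ultimately have "z * survival n x \<le> e / 3 * renewal x + z * ((L 0 + 2 * e / 3) / z * renewal x)"
          using z mult_left_mono[of "survival n x" "strip_survival b k x + (L 0 + 2 * e / 3) / z * renewal x" z]
          by (simp add: distrib_left)
        also have "z * ((L 0 + 2 * e / 3) / z * renewal x) = (L 0 + 2 * e / 3) * renewal x"
          using z by simp
        also have "e / 3 * renewal x + (L 0 + 2 * e / 3) * renewal x = (L 0 + e) * renewal x"
          by (simp add: distrib_right)
        finally show "\<sigma> * sqrt n * survival n x \<le> (L 0 + e) * renewal x"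
          unfolding z_def .
      qed
    qed
  qed
  then show ?thesis using \<epsilon>0 by blast
qed

lemma survival_bulk_lower:
  assumes a: "renewal a > 0" and e: "e > 0"
  shows "\<exists>\<epsilon>\<^sub>0>0. \<forall>\<epsilon>. 0 < \<epsilon> \<and> \<epsilon> \<le> \<epsilon>\<^sub>0 \<longrightarrow> (\<forall>\<^sub>F n in sequentially. \<forall>x. a \<le> x \<and> x \<le> \<epsilon> * (\<sigma> * sqrt n) \<longrightarrow>
      (L 0 - e) * renewal x \<le> \<sigma> * sqrt n * survival n x)"
proof -
  obtain C b\<^sub>0 where C: "C > 0" and b0: "b\<^sub>0 \<ge> 1"
    and time: "\<And>b j x. b \<ge> b\<^sub>0 \<Longrightarrow> a \<le> x \<Longrightarrow> x \<le> b \<Longrightarrow> strip_time b j x \<le> C * b * renewal x"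
    using strip_time_bound[OF a] by blast
  obtain c where c: "c > 0" "\<And>b x. b \<ge> 1 \<Longrightarrow> x \<le> b \<Longrightarrow> kill {2 * b<..} renewal x \<le> c * b powr - (1 + \<delta>)"
    using overshoot_bound by blast
  \<comment> \<open>Five losses of relative size \<open>g\<close> occur: the curvature of
    \<open>H\<close>, the limit law, the comparison of \<open>renewal y\<close> with
    \<open>y\<close>, the overshoot, and the paths still in the strip.\<close>
  define g where "g = min (e / (5 * L 0)) (1 / 4)"
  have g: "0 < g" "g \<le> 1 / 4" "5 * L 0 * g \<le> e"
    using e L_0_pos by (auto simp: g_def min_def field_simps)
  obtain B where B: "B > 0" "\<And>y. y \<ge> B \<Longrightarrow> renewal y \<le> (1 + g) * y"
    using renewal_le_asymp[OF g(1)] by blast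
  \<comment> \<open>The first entry bounds the curvature loss at
    \<open>u \<le> 2 * \<epsilon>\<close>, the second the loss from paths that remain in the
    strip.\<close>
  define \<epsilon>\<^sub>0 where "\<epsilon>\<^sub>0 = min (sqrt g / 2) (sqrt (g / (2 * C * \<sigma>\<^sup>2)))"
  have \<epsilon>0: "\<epsilon>\<^sub>0 > 0" using g C \<sigma>_pos by (simp add: \<epsilon>\<^sub>0_def)
  have main: "\<forall>\<^sub>F n in sequentially. \<forall>x. a \<le> x \<and> x \<le> \<epsilon> * (\<sigma> * sqrt n) \<longrightarrow>
      (L 0 - e) * renewal x \<le> \<sigma> * sqrt n * survival n x" if \<epsilon>: "0 < \<epsilon>" "\<epsilon> \<le> \<epsilon>\<^sub>0" for \<epsilon>
  proof -
    have "\<epsilon>\<^sup>2 \<le> (sqrt g / 2)\<^sup>2" using \<epsilon> by (intro power_mono) (auto simp: \<epsilon>\<^sub>0_def)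
    then have \<epsilon>g: "4 * \<epsilon>\<^sup>2 \<le> g" using g by (simp add: power_divide)
    have "\<epsilon>\<^sup>2 \<le> (sqrt (g / (2 * C * \<sigma>\<^sup>2)))\<^sup>2" using \<epsilon> by (intro power_mono) (auto simp: \<epsilon>\<^sub>0_def)
    also have "\<dots> = g / (2 * C * \<sigma>\<^sup>2)" using g C by (intro real_sqrt_pow2) simp
    finally have \<epsilon>C: "2 * C * \<sigma>\<^sup>2 * \<epsilon>\<^sup>2 \<le> g" using C \<sigma>_pos by (simp add: field_simps)
    have "\<epsilon>\<^sup>2 \<le> (1 / 4)\<^sup>2" using \<epsilon>g g by (simp add: power_divide)
    then have \<epsilon>4: "\<epsilon> \<le> 1 / 4" by (rule power2_le_imp_le) simp
    define d where "d = \<epsilon> * L 0 * g"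
    have d: "d > 0" using \<epsilon> g L_0_pos by (simp add: d_def)
    have lim: "filterlim (\<lambda>n. \<epsilon> * (\<sigma> * sqrt (real n))) at_top sequentially"
      by (intro filterlim_tendsto_pos_mult_at_top[OF tendsto_const] \<epsilon> scale_at_top)
    have "(\<lambda>n. c * C * (\<epsilon> * (\<sigma> * sqrt (real n))) powr - \<delta>) \<longlonglongrightarrow> c * C * 0"
      using \<delta> by (intro tendsto_intros tendsto_neg_powr lim) auto
    then have "\<forall>\<^sub>F n in sequentially. c * C * (\<epsilon> * (\<sigma> * sqrt (real n))) powr - \<delta> < g"
      using g by (intro order_tendstoD(2)) auto
    moreover have "\<forall>\<^sub>F n in sequentially. max b\<^sub>0 B \<le> \<epsilon> * (\<sigma> * sqrt (real n))"
      using lim unfolding filterlim_at_top by blast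
    moreover note survival_uniform[OF d] eventually_gt_at_top[of 0]
    ultimately show ?thesis
    proof eventually_elim
      case (elim n)
      define z where "z = \<sigma> * sqrt n"
      have z: "z > 0" using \<sigma>_pos elim by (simp add: z_def)
      have z2: "z * z = \<sigma>\<^sup>2 * n" by (simp add: z_def power2_eq_square)
      define b where "b = \<epsilon> * z"
      have b: "b \<ge> b\<^sub>0" "b \<ge> B" using elim(2) by (auto simp: b_def z_def)
      have b1: "b \<ge> 1" "b > 0" using b b0 by auto
      define \<kappa> where "\<kappa> = L 0 * (1 - 2 * g) * (1 - g) / z"
      have \<kappa>: "\<kappa> \<ge> 0" using L_0_pos g z by (simp add: \<kappa>_def)
      define \<rho> where "\<rho> = c * b powr - (1 + \<delta>)"
      have near: "\<kappa> * renewal y \<le> survival n y" if y: "b < y" "y \<le> 2 * b" for y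
      proof -
        have y0: "y > 0" using y b1 by linarith
        define u where "u = y / z"
        have u: "\<epsilon> \<le> u" "u \<le> 2 * \<epsilon>" using y z by (auto simp: u_def b_def field_simps)
        have "u\<^sup>2 \<le> (2 * \<epsilon>)\<^sup>2" using u \<epsilon> by (intro power_mono) auto
        then have "1 - g \<le> 1 - u\<^sup>2" using \<epsilon>g by (simp add: power_mult_distrib)
        then have "L 0 * (1 - g) * u \<le> L 0 * (1 - u\<^sup>2) * u"
          using L_0_pos u \<epsilon> by (intro mult_right_mono mult_left_mono) auto
        also have "\<dots> \<le> H u" using u \<epsilon> \<epsilon>4 by (intro H_ge) auto
        also have "\<dots> \<le> survival n y + d" using elim(3)[rule_format, of y] y0 by (simp add: u_def z_def abs_le_iff)
        also have "d \<le> L 0 * g * u" using u L_0_pos g by (simp add: d_def)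
        finally have 1: "L 0 * (1 - 2 * g) * u \<le> survival n y" by (simp add: algebra_simps)
        have "(1 - g) * renewal y \<le> (1 - g) * ((1 + g) * y)"
          using y b g by (intro mult_left_mono B(2)) auto
        also have "\<dots> = (1 - g\<^sup>2) * y" by (simp add: algebra_simps power2_eq_square)
        also have "\<dots> \<le> 1 * y" using y0 by (intro mult_right_mono) auto
        finally have 2: "(1 - g) * renewal y \<le> y" by simp
        have "\<kappa> * renewal y = L 0 * (1 - 2 * g) / z * ((1 - g) * renewal y)" by (simp add: \<kappa>_def)
        also have "\<dots> \<le> L 0 * (1 - 2 * g) / z * y"
          using L_0_pos g z by (intro mult_left_mono 2) auto
        also have "\<dots> = L 0 * (1 - 2 * g) * u" by (simp add: u_def)
        finally show ?thesis using 1 by linarith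
      qed
      show ?case
      proof (intro allI impI)
        fix x assume "a \<le> x \<and> x \<le> \<epsilon> * (\<sigma> * sqrt n)"
        then have x: "a \<le> x" "x \<le> b" by (auto simp: b_def z_def)
        have R: "renewal x \<ge> 0" by (rule renewal_nonneg)
        have E: "strip_time b n x \<le> C * b * renewal x" using b x by (intro time)
        have low: "\<kappa> * (renewal x - renewal b * strip_survival b n x - \<rho> * strip_time b n x) \<le> survival n x"
          by (rule survival_lower[where n = n]) (use \<kappa> b1 near c x in \<open>auto simp: \<rho>_def\<close>)
        have "\<rho> * strip_time b n x \<le> \<rho> * (C * b * renewal x)"
          using c by (intro mult_left_mono E) (simp add: \<rho>_def)
        also have "\<dots> = c * C * (b powr - (1 + \<delta>) * b powr 1) * renewal x" using b1 by (simp add: \<rho>_def)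
        also have "b powr - (1 + \<delta>) * b powr 1 = b powr - \<delta>" unfolding powr_add[symmetric] by simp
        also have "c * C * b powr - \<delta> * renewal x \<le> g * renewal x"
          using elim(1) R by (intro mult_right_mono) (auto simp: b_def z_def)
        finally have 1: "\<rho> * strip_time b n x \<le> g * renewal x" .
        \<comment> \<open>Here Markov's inequality uses all \<open>n\<close> steps; with
          \<open>renewal b \<le> 2 * b\<close> and \<open>b = \<epsilon> * z\<close> the loss is of
          order \<open>\<epsilon>\<^sup>2\<close>.\<close>
        have "n * (renewal b * strip_survival b n x) = renewal b * (n * strip_survival b n x)" by simp
        also have "\<dots> \<le> ((1 + g) * b) * (C * b * renewal x)"
          using b1 g strip_survival_nonneg[of b n x]
          by (intro mult_mono[OF B(2)[OF b(2)] order_trans[OF strip_survival_le_strip_time E]]) auto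
        also have "\<dots> \<le> (2 * b) * (C * b * renewal x)"
          using g b1 C R by (intro mult_right_mono) auto
        also have "\<dots> = 2 * C * \<epsilon>\<^sup>2 * (z * z) * renewal x" by (simp add: b_def power2_eq_square)
        also have "\<dots> = n * (2 * C * \<sigma>\<^sup>2 * \<epsilon>\<^sup>2 * renewal x)" unfolding z2 by simp
        finally have "renewal b * strip_survival b n x \<le> 2 * C * \<sigma>\<^sup>2 * \<epsilon>\<^sup>2 * renewal x"
          using elim(4) by (subst (asm) mult_le_cancel_left_pos) auto
        also have "\<dots> \<le> g * renewal x" using \<epsilon>C R by (intro mult_right_mono)
        finally have 2: "(1 - 2 * g) * renewal x \<le> renewal x - renewal b * strip_survival b n x - \<rho> * strip_time b n x"
          using 1 by (simp add: algebra_simps)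
        have "z * (\<kappa> * ((1 - 2 * g) * renewal x)) \<le> z * survival n x"
          using low mult_left_mono[OF 2 \<kappa>] z by (intro mult_left_mono) auto
        moreover have "z * (\<kappa> * ((1 - 2 * g) * renewal x)) = L 0 * ((1 - 2 * g) * (1 - g) * (1 - 2 * g)) * renewal x"
          using z by (simp add: \<kappa>_def)
        moreover have "L 0 * (1 - 5 * g) * renewal x \<le> L 0 * ((1 - 2 * g) * (1 - g) * (1 - 2 * g)) * renewal x"
        proof (intro mult_right_mono mult_left_mono)
          have "(1 - 2 * g) * (1 - g) * (1 - 2 * g) - (1 - 5 * g) = g * g * (8 - 4 * g)" by (simp add: algebra_simps)
          moreover have "0 \<le> g * g * (8 - 4 * g)" using g by (intro mult_nonneg_nonneg) auto
          ultimately show "1 - 5 * g \<le> (1 - 2 * g) * (1 - g) * (1 - 2 * g)" by linarith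
        qed (use L_0_pos R in auto)
        moreover have "(L 0 - e) * renewal x \<le> L 0 * (1 - 5 * g) * renewal x"
          using g R by (intro mult_right_mono) (auto simp: algebra_simps)
        ultimately show "(L 0 - e) * renewal x \<le> \<sigma> * sqrt n * survival n x"
          unfolding z_def[symmetric] by linarith
      qed
    qed
  qed
  then show ?thesis using \<epsilon>0 by blast
qed

text \<open>The starting points are split at \<open>\<epsilon> * z\<close>. Below it the bulk
  estimates apply and \<open>L\<close> is close to \<open>L 0\<close>; above it the limit law
  applies and \<open>renewal x / x\<close> is close to 1.\<close>

theorem survival_equivalent:
  assumes a: "renewal a > 0" and e: "0 < e" "e \<le> 1"
  shows "\<forall>\<^sub>F n in sequentially. \<forall>x\<ge>a.
    \<bar>\<sigma> * sqrt n * survival n x / (renewal x * L (x / (\<sigma> * sqrt n))) - 1\<bar> \<le> e"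
proof -
  have "L 0 * e / 4 > 0" using L_0_pos e by simp
  note bulk = survival_bulk_upper[OF a this] survival_bulk_lower[OF a this]
  obtain \<epsilon>1 where \<epsilon>1: "\<epsilon>1 > 0"
    "\<And>\<epsilon>. 0 < \<epsilon> \<Longrightarrow> \<epsilon> \<le> \<epsilon>1 \<Longrightarrow> \<forall>\<^sub>F n in sequentially. \<forall>x. a \<le> x \<and> x \<le> \<epsilon> * (\<sigma> * sqrt n) \<longrightarrow>
      \<sigma> * sqrt n * survival n x \<le> (L 0 + L 0 * e / 4) * renewal x"
    using bulk(1) by blast
  obtain \<epsilon>2 where \<epsilon>2: "\<epsilon>2 > 0"
    "\<And>\<epsilon>. 0 < \<epsilon> \<Longrightarrow> \<epsilon> \<le> \<epsilon>2 \<Longrightarrow> \<forall>\<^sub>F n in sequentially. \<forall>x. a \<le> x \<and> x \<le> \<epsilon> * (\<sigma> * sqrt n) \<longrightarrow>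
      (L 0 - L 0 * e / 4) * renewal x \<le> \<sigma> * sqrt n * survival n x"
    using bulk(2) by blast
  define \<epsilon> where "\<epsilon> = min (min \<epsilon>1 \<epsilon>2) (sqrt (e / 4))"
  have \<epsilon>: "0 < \<epsilon>" "\<epsilon> \<le> \<epsilon>1" "\<epsilon> \<le> \<epsilon>2" "\<epsilon> \<le> sqrt (e / 4)" using \<epsilon>1(1) \<epsilon>2(1) e by (auto simp: \<epsilon>_def)
  have "\<epsilon>\<^sup>2 \<le> (sqrt (e / 4))\<^sup>2" using \<epsilon> by (intro power_mono) auto
  then have \<epsilon>e: "\<epsilon>\<^sup>2 \<le> e / 4" using e by simp
  then have "\<epsilon>\<^sup>2 \<le> 1\<^sup>2" using e by simp
  then have \<epsilon>_1: "\<epsilon> \<le> 1" by (rule power2_le_imp_le) simp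
  \<comment> \<open>Since \<open>H u \<ge> H \<epsilon>\<close> above the split, this additive error
    is a relative one of size \<open>e / 4\<close>.\<close>
  define d where "d = H \<epsilon> * e / 4"
  have d: "d > 0" using H_pos[OF \<epsilon>(1)] e by (simp add: d_def)
  obtain B where B: "B > 0" "\<And>y. y \<ge> B \<Longrightarrow> renewal y \<le> (1 + e / 4) * y"
    using renewal_le_asymp[of "e / 4"] e by auto
  have lim: "filterlim (\<lambda>n. \<epsilon> * (\<sigma> * sqrt (real n))) at_top sequentially"
    by (intro filterlim_tendsto_pos_mult_at_top[OF tendsto_const] \<epsilon> scale_at_top)
  \<comment> \<open>The term \<open>\<bar>a\<bar>\<close> brings negative starting points within
    distance \<open>\<epsilon> * z\<close> of zero, as the bound on \<open>L\<close> requires;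
    \<open>B\<close> makes the asymptotics of \<open>renewal\<close> valid above the split.\<close>
  then have "\<forall>\<^sub>F n in sequentially. max \<bar>a\<bar> B \<le> \<epsilon> * (\<sigma> * sqrt (real n))"
    unfolding filterlim_at_top by blast
  with \<epsilon>1(2)[OF \<epsilon>(1,2)] \<epsilon>2(2)[OF \<epsilon>(1,3)] survival_uniform[OF d] eventually_gt_at_top[of 0]
  show ?thesis
  proof eventually_elim
    case (elim n)
    define z where "z = \<sigma> * sqrt n"
    have z: "z > 0" using \<sigma>_pos elim by (simp add: z_def)
    show ?case
    proof (intro allI impI)
      fix x assume x: "a \<le> x"
      have R: "renewal x > 0" using a monoD[OF mono_renewal x] by linarith
      define u where "u = x / z"
      define num where "num = z * survival n x"
      define den where "den = renewal x * L u"
      have "den > 0 \<and> (1 - e) * den \<le> num \<and> num \<le> (1 + e) * den"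
      proof (cases "x \<le> \<epsilon> * z")
        case True
        have "\<bar>x\<bar> \<le> \<epsilon> * z" using True x elim(5) unfolding z_def by linarith
        then have u: "\<bar>u\<bar> \<le> \<epsilon>" using z by (simp add: u_def abs_divide pos_divide_le_eq)
        then have "u\<^sup>2 \<le> \<epsilon>\<^sup>2" using \<epsilon>(1) by (simp add: abs_le_square_iff[symmetric])
        then have "L 0 * (1 - e / 4) \<le> L 0 * (1 - u\<^sup>2)" using \<epsilon>e L_0_pos by (intro mult_left_mono) auto
        also have "\<dots> \<le> L u" using u \<epsilon>_1 by (intro L_ge) linarith
        finally have Lu: "L 0 * (1 - e / 4) \<le> L u" .
        have pos: "L 0 * (1 - e / 4) > 0" using L_0_pos e by simp
        then have "den > 0" using R Lu by (simp add: den_def)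
        moreover have "(1 - e) * den \<le> num"
        proof -
          have "(1 - e) * den \<le> (1 - e / 4) * (renewal x * L 0)"
            unfolding den_def using L_le[of u] R e pos Lu by (intro mult_mono mult_left_mono) auto
          also have "\<dots> = (L 0 - L 0 * e / 4) * renewal x" by (simp add: algebra_simps)
          also have "\<dots> \<le> num" using elim(2) x True by (simp add: num_def z_def)
          finally show ?thesis .
        qed
        moreover have "num \<le> (1 + e) * den"
        proof -
          have "num \<le> (L 0 + L 0 * e / 4) * renewal x" using elim(1) x True by (simp add: num_def z_def)
          also have "\<dots> = (1 + e / 4) * (L 0 * renewal x)" by (simp add: algebra_simps)
          also have "\<dots> \<le> ((1 + e) * (1 - e / 4)) * (L 0 * renewal x)"
          proof (intro mult_right_mono)
            have "e * e \<le> 1 * e" using e by (intro mult_right_mono) auto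
            moreover have "(1 + e) * (1 - e / 4) = 1 + 3 / 4 * e - e * e / 4" by (simp add: field_simps)
            ultimately show "1 + e / 4 \<le> (1 + e) * (1 - e / 4)" using e by linarith
          qed (use R L_0_pos in auto)
          also have "\<dots> = (1 + e) * (renewal x * (L 0 * (1 - e / 4)))" by simp
          also have "\<dots> \<le> (1 + e) * den"
            unfolding den_def using R e Lu by (intro mult_left_mono) auto
          finally show ?thesis .
        qed
        ultimately show ?thesis by blast
      next
        case False
        then have xz: "\<epsilon> * z < x" by simp
        have x0: "x > 0" using xz \<epsilon> z by (meson less_trans mult_pos_pos)
        have u: "\<epsilon> \<le> u" using xz z by (simp add: u_def pos_le_divide_eq)
        have Hu: "H \<epsilon> \<le> H u" "H u > 0" using u \<epsilon> by (auto intro: mono_H H_pos)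
        have "d \<le> H u * e / 4" using Hu e by (simp add: d_def mult_right_mono)
        moreover have "\<bar>survival n x - H u\<bar> \<le> d" using elim(3) x0 by (simp add: u_def z_def)
        ultimately have s: "(1 - e / 4) * H u \<le> survival n x" "survival n x \<le> (1 + e / 4) * H u"
          by (auto simp: abs_le_iff algebra_simps)
        have den: "den = renewal x / x * (z * H u)"
          using x0 z by (simp add: den_def H_eq u_def)
        have r: "1 \<le> renewal x / x" "renewal x / x \<le> 1 + e / 4"
          using pos_part_le_renewal[of x] B(2)[of x] x0 xz elim(5) by (auto simp: field_simps z_def)
        have zH: "z * H u > 0" using z Hu by simp
        have "den > 0" unfolding den by (rule mult_pos_pos[OF _ zH]) (use r(1) in linarith)
        moreover have "(1 - e) * den \<le> num"
        proof -
          have "(1 - e) * den = (1 - e) * (renewal x / x) * (z * H u)" by (simp add: den)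
          also have "\<dots> \<le> (1 - e / 4) * (z * H u)"
          proof (intro mult_right_mono)
            have "(1 - e) * (renewal x / x) \<le> (1 - e) * (1 + e / 4)" using e r by (intro mult_left_mono) auto
            also have "\<dots> = 1 - 3 / 4 * e - e * e / 4" by (simp add: field_simps)
            also have "\<dots> \<le> 1 - e / 4" using e zero_le_square[of e] by linarith
            finally show "(1 - e) * (renewal x / x) \<le> 1 - e / 4" .
          qed (use zH in simp)
          also have "\<dots> = z * ((1 - e / 4) * H u)" by simp
          also have "\<dots> \<le> num" unfolding num_def using s z by (intro mult_left_mono) auto
          finally show ?thesis .
        qed
        moreover have "num \<le> (1 + e) * den"
        proof -
          have "num \<le> z * ((1 + e / 4) * H u)" unfolding num_def using s z by (intro mult_left_mono) auto
          also have "\<dots> = (1 + e / 4) * (z * H u)" by simp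
          also have "\<dots> \<le> ((1 + e) * (renewal x / x)) * (z * H u)"
          proof (intro mult_right_mono)
            have "1 + e / 4 \<le> (1 + e) * 1" using e by simp
            also have "\<dots> \<le> (1 + e) * (renewal x / x)" using e r by (intro mult_left_mono) auto
            finally show "1 + e / 4 \<le> (1 + e) * (renewal x / x)" .
          qed (use zH in simp)
          also have "\<dots> = (1 + e) * den" by (simp add: den)
          finally show ?thesis .
        qed
        ultimately show ?thesis by blast
      qed
      then have "1 - e \<le> num / den" "num / den \<le> 1 + e"
        by (auto simp: pos_le_divide_eq pos_divide_le_eq)
      then show "\<bar>\<sigma> * sqrt n * survival n x / (renewal x * L (x / (\<sigma> * sqrt n))) - 1\<bar> \<le> e"
        unfolding num_def den_def u_def z_def by linarith
    qed
  qed
qed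

text \<open>The supremum is taken in \<open>ereal\<close>, where it always exists. A real number
  below the given threshold, capped at 1, serves as the error in
  \<open>survival_equivalent\<close>.\<close>

lemma survival_sup_tendsto:
  assumes a: "a \<in> supp_V M X"
  shows "(\<lambda>n. SUP x\<in>{a..}. ereal \<bar>\<sigma> * sqrt (real n) * measure M {\<omega> \<in> space M. exit_time X x \<omega> > enat n}
                    / (V M X x * L (x / (\<sigma> * sqrt (real n)))) - 1\<bar>) \<longlonglongrightarrow> 0"
    (is "?f \<longlonglongrightarrow> 0")
proof (rule order_tendstoI)
  fix c :: ereal assume "c < 0"
  have "0 \<le> ?f n" for n by (rule SUP_upper2[of a]) auto
  then show "\<forall>\<^sub>F n in sequentially. c < ?f n"
    using \<open>c < 0\<close> by (intro always_eventually allI) (rule less_le_trans)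
next
  fix c :: ereal assume "0 < c"
  then obtain e' where e': "0 < ereal e'" "ereal e' < c" by (blast dest: ereal_dense2)
  define e where "e = min e' 1"
  have e: "0 < e" "e \<le> 1" using e' by (auto simp: e_def)
  have "ereal e \<le> ereal e'" by (simp add: e_def)
  then have ec: "ereal e < c" using e'(2) by (rule le_less_trans)
  have "renewal a > 0" using a by (simp add: supp_V_def V_eq_renewal)
  from survival_equivalent[OF this e(1,2)]
  show "\<forall>\<^sub>F n in sequentially. ?f n < c"
  proof eventually_elim
    case (elim n)
    have "?f n \<le> ereal e"
      by (rule SUP_least) (use elim in \<open>simp add: survival_eq_prob V_eq_renewal\<close>)
    then show ?case using ec by (rule le_less_trans)
  qed
qed

end

theorem corollary1p2:
  fixes M :: "'a measure" and X :: "nat \<Rightarrow> 'a \<Rightarrow> real" and \<sigma> :: real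
  assumes "prob_space M"
    and "prob_space.indep_vars M (\<lambda>_. borel) X {1..}"
    and "\<And>i. 1 \<le> i \<Longrightarrow> distr M borel (X i) = distr M borel (X 1)"
    and "(\<integral>\<omega>. X 1 \<omega> \<partial>M) = 0"
    and "(\<integral>\<omega>. (X 1 \<omega>)\<^sup>2 \<partial>M) = \<sigma>\<^sup>2"
    and "\<sigma> > 0"
    and "\<exists>\<delta>>0. integrable M (\<lambda>\<omega>. \<bar>X 1 \<omega>\<bar> powr (2 + \<delta>))"
  shows "(\<forall>a \<in> supp_V M X.
            (\<lambda>n. SUP x\<in>{a..}. ereal \<bar>\<sigma> * sqrt (real n) * measure M {\<omega> \<in> space M. exit_time X x \<omega> > enat n}
                    / (V M X x * L (x / (\<sigma> * sqrt (real n)))) - 1\<bar>) \<longlonglongrightarrow> 0)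
       \<and> 0 \<in> supp_V M X
       \<and> (\<lambda>n. SUP x\<in>{0..}. ereal \<bar>\<sigma> * sqrt (real n) * measure M {\<omega> \<in> space M. exit_time X x \<omega> > enat n}
                    / (V M X x * L (x / (\<sigma> * sqrt (real n)))) - 1\<bar>) \<longlonglongrightarrow> 0"
proof -
  interpret prob_space M by fact
  obtain \<delta> where \<delta>: "\<delta> > 0" and int: "integrable M (\<lambda>\<omega>. \<bar>X 1 \<omega>\<bar> powr (2 + \<delta>))"
    using assms(7) by blast
  have X1: "X 1 \<in> borel_measurable M" using assms(2) by (auto simp: indep_vars_def)
  have bound: "integrable M (\<lambda>\<omega>. 1 + \<bar>X 1 \<omega>\<bar> powr (2 + \<delta>))" using int by auto
  \<comment> \<open>Lower absolute moments are finite as well: exponent 1 gives integrable steps,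
    and an exponent between 2 and 3 allows \<delta> to be lowered.\<close>
  have le: "\<bar>t\<bar> powr r \<le> 1 + \<bar>t\<bar> powr (2 + \<delta>)" if "0 < r" "r \<le> 2 + \<delta>" for t r :: real
  proof (cases "\<bar>t\<bar> \<le> 1")
    case True
    then have "\<bar>t\<bar> powr r \<le> 1 powr r" using that by (intro powr_mono2) auto
    then show ?thesis by (simp add: add_increasing2)
  next
    case False
    then have "\<bar>t\<bar> powr r \<le> \<bar>t\<bar> powr (2 + \<delta>)" using that by (intro powr_mono) auto
    then show ?thesis by simp
  qed
  have intr: "integrable M (\<lambda>\<omega>. \<bar>X 1 \<omega>\<bar> powr r)" if "0 < r" "r \<le> 2 + \<delta>" for r
  proof (rule Bochner_Integration.integrable_bound[OF bound])
    have "(\<lambda>t. \<bar>t :: real\<bar> powr r) \<in> borel_measurable borel" by measurable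
    then show "(\<lambda>\<omega>. \<bar>X 1 \<omega>\<bar> powr r) \<in> borel_measurable M" by (rule measurable_compose[OF X1])
    show "AE \<omega> in M. norm (\<bar>X 1 \<omega>\<bar> powr r) \<le> norm (1 + \<bar>X 1 \<omega>\<bar> powr (2 + \<delta>))"
      using le[OF that] by (intro AE_I2) simp
  qed
  have "integrable M (\<lambda>\<omega>. \<bar>X 1 \<omega>\<bar>)" using intr[of 1] \<delta> by simp
  then have X1_int: "integrable M (X 1)" by (simp only: integrable_abs_iff[OF X1])
  define \<delta>' where "\<delta>' = min \<delta> (1 / 2)"
  have \<delta>': "0 < \<delta>'" "\<delta>' < 1" "\<delta>' \<le> \<delta>" using \<delta> by (auto simp: \<delta>'_def)
  interpret centred_walk M X \<sigma> \<delta>'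
    by unfold_locales (fact assms(2) assms(3) assms(4) assms(5) assms(6) X1_int \<delta>'(1) \<delta>'(2)
        | rule intr, use \<delta>' in simp, use \<delta>' in simp)+
  have "0 \<in> supp_V M X" using renewal_0_pos by (simp add: supp_V_def V_eq_renewal)
  then show ?thesis using survival_sup_tendsto by blast
qed

end
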